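(* Let $A\in\mathbb{R}^{n\times n}$ and consider the discrete-time system $x(k+1)=A\,x(k)$, $k\in\mathbb{N}$. For $\eta\in(0,1)$ let $$A^{\mathrm{dt}}_\eta := \frac{1}{\eta}A-\frac{1-\eta}{\eta}I .$$ The following statements are equivalent: (a) the system $x(k+1)=Ax(k)$ is convergent; (b) there exists $\eta\in(0,1)$ such that the system $x(k+1)=A^{\mathrm{dt}}_\eta x(k)$ is (marginally) stable; (c) there exists a weak polyhedral Lyapunov function for the system $x(k+1)=A^{\mathrm{dt}}_\eta x(k)$ for some $\eta\in(0,1)$; (d) there exists an invertible matrix $T\in\mathbb{R}^{n\times n}$ such that $$T^{-1}AT=\begin{bmatrix}A^{\mathrm{as}} & 0\\ A^{\mathrm{r}} & I\end{bmatrix}$$ for some Schur matrix $A^{\mathrm{as}}$; (e) there exist $\eta\in(0,1)$ and $P\succ 0$ such that $$\eta(A^\top PA-P)+(1-\eta)(A^\top-I)P(A-I)\preccurlyeq 0;$$ (f) there exist $Q\succ 0$ and $P\succcurlyeq 0$ with $\mathrm{rank}(P)=n-\dim(\ker(A-I))$ such that $$A^\top PA-P+(A^\top-I)Q(A-I)\preccurlyeq 0 .$$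
   Context: The system $x(k+1)=Ax(k)$ is convergent if for every $x(0)\in\mathbb{R}^n$ there exists $\bar x\in\mathbb{R}^n$ such that the solution satisfies $\lim_{k\to\infty}\|x(k)-\bar x\|=0$. A system is (marginally) stable if it is at least marginally stable, i.e. the origin is Lyapunov stable (asymptotic stability is not required). A weak Lyapunov function for $x(k+1)=Fx(k)$ is a positive definite function $V:\mathbb{R}^n\to\mathbb{R}_{\ge 0}$ with $V(Fx)\le V(x)$ for all $x\in\mathbb{R}^n$; it is a weak polyhedral Lyapunov function if moreover $V$ is polyhedral, i.e. $V(x)=\max_{i=1,\dots,s} f_i^\top x$ for some vectors $f_1,\dots,f_s\in\mathbb{R}^n$. A Schur matrix is a square matrix with all eigenvalues strictly inside the unit disk. Blocks in (d) may be empty. $P\succ 0$ ($P\succcurlyeq 0$) means that $P$ is symmetric positive definite (semi-definite), and $M\preccurlyeq 0$ means $-M\succcurlyeq 0$. *)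

theory Defs
  imports
    Complex_Main
    "Jordan_Normal_Form.Char_Poly"
    "Jordan_Normal_Form.Matrix_Kernel"
    "Jordan_Normal_Form.DL_Rank"
begin

definition vec_norm :: "real vec \<Rightarrow> real" where
  "vec_norm v = sqrt (v \<bullet> v)"

primrec trajectory :: "real mat \<Rightarrow> real vec \<Rightarrow> nat \<Rightarrow> real vec" where
  "trajectory A x0 0 = x0"
| "trajectory A x0 (Suc k) = A *\<^sub>v trajectory A x0 k"

definition convergent_system :: "nat \<Rightarrow> real mat \<Rightarrow> bool" where
  "convergent_system n A \<longleftrightarrow>
     (\<forall>x0 \<in> carrier_vec n. \<exists>xbar \<in> carrier_vec n.
        (\<lambda>k. vec_norm (trajectory A x0 k - xbar)) \<longlonglongrightarrow> 0)"

text \<open>Lyapunov stability of the origin; attractivity is not required.\<close>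

definition marginally_stable_system :: "nat \<Rightarrow> real mat \<Rightarrow> bool" where
  "marginally_stable_system n A \<longleftrightarrow>
     (\<forall>\<epsilon>>0. \<exists>\<delta>>0. \<forall>x0 \<in> carrier_vec n.
        vec_norm x0 < \<delta> \<longrightarrow> (\<forall>k. vec_norm (trajectory A x0 k) < \<epsilon>))"

definition A_dt :: "nat \<Rightarrow> real mat \<Rightarrow> real \<Rightarrow> real mat" where
  "A_dt n A \<eta> = (1 / \<eta>) \<cdot>\<^sub>m A - ((1 - \<eta>) / \<eta>) \<cdot>\<^sub>m 1\<^sub>m n"

definition pos_def_fun :: "nat \<Rightarrow> (real vec \<Rightarrow> real) \<Rightarrow> bool" where
  "pos_def_fun n V \<longleftrightarrow>
     V (0\<^sub>v n) = 0 \<and> (\<forall>x \<in> carrier_vec n. x \<noteq> 0\<^sub>v n \<longrightarrow> V x > 0)"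

definition weak_lyapunov :: "nat \<Rightarrow> real mat \<Rightarrow> (real vec \<Rightarrow> real) \<Rightarrow> bool" where
  "weak_lyapunov n F V \<longleftrightarrow>
     pos_def_fun n V \<and> (\<forall>x \<in> carrier_vec n. V (F *\<^sub>v x) \<le> V x)"

definition polyhedral_fun :: "nat \<Rightarrow> (real vec \<Rightarrow> real) \<Rightarrow> bool" where
  "polyhedral_fun n V \<longleftrightarrow>
     (\<exists>(s::nat) (f :: nat \<Rightarrow> real vec). s \<ge> 1 \<and> (\<forall>i \<in> {1..s}. f i \<in> carrier_vec n) \<and>
        (\<forall>x \<in> carrier_vec n. V x = (MAX i \<in> {1..s}. f i \<bullet> x)))"

definition weak_polyhedral_lyapunov :: "nat \<Rightarrow> real mat \<Rightarrow> (real vec \<Rightarrow> real) \<Rightarrow> bool" where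
  "weak_polyhedral_lyapunov n F V \<longleftrightarrow> weak_lyapunov n F V \<and> polyhedral_fun n V"

text \<open>The eigenvalues of a real matrix are taken over the complex numbers.  The empty matrix has
  no eigenvalues and hence is Schur.\<close>

definition schur_mat :: "real mat \<Rightarrow> bool" where
  "schur_mat M \<longleftrightarrow> square_mat M \<and>
     (\<forall>z. eigenvalue (map_mat complex_of_real M) z \<longrightarrow> cmod z < 1)"

definition pos_def_mat :: "nat \<Rightarrow> real mat \<Rightarrow> bool" where
  "pos_def_mat n P \<longleftrightarrow> P \<in> carrier_mat n n \<and> P\<^sup>T = P \<and>
     (\<forall>x \<in> carrier_vec n. x \<noteq> 0\<^sub>v n \<longrightarrow> x \<bullet> (P *\<^sub>v x) > 0)"

definition pos_semidef_mat :: "nat \<Rightarrow> real mat \<Rightarrow> bool" where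
  "pos_semidef_mat n P \<longleftrightarrow> P \<in> carrier_mat n n \<and> P\<^sup>T = P \<and>
     (\<forall>x \<in> carrier_vec n. x \<bullet> (P *\<^sub>v x) \<ge> 0)"

definition neg_semidef_mat :: "nat \<Rightarrow> real mat \<Rightarrow> bool" where
  "neg_semidef_mat n M \<longleftrightarrow> pos_semidef_mat n (- M)"

end

theory Submission
  imports
    Defs
    "Jordan_Normal_Form.Spectral_Radius"
    "HOL-Analysis.L2_Norm"
begin

text \<open>
  Every condition turns out to say that 1 is a semisimple eigenvalue of \<open>A\<close> (or no eigenvalue at
  all) and that all other eigenvalues lie strictly inside the unit disk.  The block form is the
  algebraic version of this: the last coordinates span the fixed space of \<open>A\<close>, and \<open>A\<^sup>a\<^sup>s\<close> carries
  the remaining spectrum.  It is the hub of the proof, because it is what the analytic conditions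
  produce and what the Lyapunov functions are built from.

  \<^bold>\<open>From the block form outwards.\<close>  The increments \<open>A\<^sup>k\<^sup>+\<^sup>1 - A\<^sup>k\<close> only involve powers of the
  Schur block, so they decay geometrically and \<open>A\<^sup>k\<close> converges geometrically to a projection
  \<open>L\<close> with \<open>A L = L A = L\<close> (\<open>fixed_block_form_pow_limit\<close>).  This is convergence of the
  system.  The deviations \<open>D\<^sub>j = A\<^sup>j - L\<close> satisfy \<open>D\<^sub>j A = D\<^sub>j\<^sub>+\<^sub>1\<close>, that is, one step
  along the system shifts the sequence of deviations.  Weighting \<open>D\<^sub>j\<close> by \<open>\<rho>\<^sup>-\<^sup>j\<close>, with
  \<open>\<rho> < 1\<close> larger than the decay rate, and combining finitely many of them therefore gives functions
  that contract under \<open>A\<close>: the maximum of the absolute values of the coordinates of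
  \<open>\<rho>\<^sup>-\<^sup>j D\<^sub>j x\<close> is polyhedral, and the sum \<open>U\<close> of \<open>\<rho>\<^sup>-\<^sup>2\<^sup>j |D\<^sub>j x|\<^sup>2\<close> is quadratic.  Adding
  \<open>L x\<close>, which is constant along trajectories, makes both positive definite.  If \<open>\<eta>\<close> is close to
  1, the slack in the contraction pays for the difference between \<open>A\<close> and its extrapolation
  \<open>A / \<eta> - ((1 - \<eta>) / \<eta>) I\<close> (\<open>polyhedral_certificate\<close>, \<open>quadratic_certificate\<close>).  The rank
  condition holds because the kernel of \<open>U\<close> is exactly the fixed space of \<open>A\<close>.

  \<^bold>\<open>Back to the block form.\<close>  A homogeneous continuous weak Lyapunov function is bounded
  below by a multiple of a power of the norm, by compactness of the unit sphere, and so makes the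
  system stable.  Stability of \<open>F = A / \<eta> - ((1 - \<eta>) / \<eta>) I\<close> bounds its powers: this excludes a
  drift \<open>F x = x + y\<close> with \<open>F y = y \<noteq> 0\<close> and puts the eigenvalues \<open>\<mu>\<close> of \<open>F\<close> in the closed
  disk, and then \<open>\<eta> \<mu> + (1 - \<eta>)\<close>, a proper average of \<open>\<mu>\<close> and 1, lies in the open disk unless
  \<open>\<mu> = 1\<close>.  Convergence of the system and the last matrix inequality are even simpler to use: both
  force \<open>A\<^sup>k (A - I) x \<rightarrow> 0\<close>, the inequality by telescoping.  In all cases
  \<open>fixed_block_form_if_semisimple\<close> concludes.
\<close>

section \<open>Ranks, kernels and adapted coordinates\<close>

lemma mult_mat_zero_vec:
  fixes M :: "'a :: comm_ring_1 mat"
  assumes "M \<in> carrier_mat nr nc"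
  shows "M *\<^sub>v 0\<^sub>v nc = 0\<^sub>v nr"
  using assms by (intro eq_vecI) (auto simp: scalar_prod_def)

text \<open>
  Rank-nullity for the linear map \<open>x \<mapsto> P x\<close>, whose image is the column space.
\<close>

lemma rank_plus_kernel_dim:
  fixes P :: "'a :: field mat"
  assumes P: "P \<in> carrier_mat n n"
  shows "vec_space.rank n P + kernel_dim P = n"
proof -
  interpret K: kernel n n P by unfold_locales (rule P)
  interpret L: linear_map class_ring "module_vec TYPE('a) n" "module_vec TYPE('a) n" "(*\<^sub>v) P"
    by unfold_locales
      (insert P, auto simp: module_hom_def mult_add_distrib_mat_vec mult_mat_vec module_vec_simps)
  have im: "L.imT = K.NC.span (set (cols P))"
    using K.NC.col_space_eq[OF P] P
    by (auto simp: LinearCombinations.module.span_def K.NC.col_space_def mod_hom.im_def L.im_def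
        module_vec_simps)
  have ker: "L.kerT = mat_kernel P"
    using P by (auto simp: L.ker_def mat_kernel module_vec_simps)
  have "vec_space.rank n P + K.dim = K.NC.dim"
    using L.rank_nullity[OF K.NC.fin_dim] unfolding im ker K.NC.rank_def by simp
  then show ?thesis by (simp add: K.NC.dim_is_n)
qed

lemma kernel_dim_cong:
  fixes M N :: "'a :: field mat"
  assumes "M \<in> carrier_mat n n" "N \<in> carrier_mat n n" "mat_kernel M = mat_kernel N"
  shows "kernel_dim M = kernel_dim N"
  using assms by (simp add: kernel_dim_def)

text \<open>
  A basis of the kernel is completed to a basis of the whole space, and the kernel vectors are listed
  last.  In the coordinates given by \<open>T\<close> the kernel is then spanned by the last \<open>r\<close> unit vectors,
  which is where a lower triangular block form wants the fixed vectors.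
\<close>

lemma invertible_extending_kernel_basis:
  fixes N :: "'a :: field mat"
  assumes N: "N \<in> carrier_mat n n"
  obtains m r T S where "m + r = n" "T \<in> carrier_mat n n" "S \<in> carrier_mat n n"
    "T * S = 1\<^sub>m n" "S * T = 1\<^sub>m n" "\<And>j. m \<le> j \<Longrightarrow> j < n \<Longrightarrow> col T j \<in> mat_kernel N"
    "\<And>x. x \<in> mat_kernel N \<Longrightarrow> \<exists>w \<in> carrier_vec r. x = T *\<^sub>v (0\<^sub>v m @\<^sub>v w)"
proof -
  interpret K: kernel n n N by unfold_locales (rule N)
  obtain B where finB: "finite B" and B: "K.basis B"
    using kernel_basis_exists[OF N] by auto
  have Bker: "B \<subseteq> mat_kernel N" and liB: "\<not> K.NC.lin_dep B"
    and spB: "K.NC.span B = mat_kernel N"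
    using B K.lindep_same[of B] K.span_same[of B] by (auto simp: K.Ker.basis_def)
  have Bc: "B \<subseteq> carrier_vec n" using Bker mat_kernel_carrier[OF N] by auto
  let ?P = "\<lambda>C. C \<subseteq> carrier_vec n \<and> \<not> K.NC.lin_dep C"
  have "finite D \<and> card D \<le> n" if "B \<subseteq> D \<and> ?P D" for D
  proof -
    from that have "D \<subseteq> carrier_vec n" "\<not> K.NC.lin_dep D" by blast+
    from K.NC.li_le_dim[OF K.NC.fin_dim this] show ?thesis by (simp add: K.NC.dim_is_n)
  qed
  moreover have "B \<subseteq> B \<and> ?P B" using Bc liB by blast
  ultimately obtain C where finC: "finite C" and "maximal C (\<lambda>C. B \<subseteq> C \<and> ?P C)"
    using maximal_exists[of "\<lambda>C. B \<subseteq> C \<and> ?P C" n B] by blast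
  then have BC: "B \<subseteq> C" and mx: "maximal C ?P"
    unfolding maximal_def by (blast, blast)
  have bC: "K.NC.basis C" using K.NC.max_li_is_basis[of C] mx by simp
  then have cC: "card C = n" using K.NC.dim_basis[OF finC] K.NC.dim_is_n by simp
  have Cc: "C \<subseteq> carrier_vec n" and liC: "\<not> K.NC.lin_dep C"
    using mx by (auto simp: maximal_def)
  obtain ks where ks: "set ks = B" "distinct ks" using finite_distinct_list[OF finB] by auto
  obtain cs where cs: "set cs = C - B" "distinct cs"
    using finite_distinct_list[of "C - B"] finC by auto
  let ?l = "cs @ ks"
  have setl: "set ?l = C" and dl: "distinct ?l" using ks cs BC by auto
  then have ll: "length ?l = n" using cC distinct_card[of ?l] by simp
  define T where "T = mat_of_cols n ?l"
  have T: "T \<in> carrier_mat n n" using ll by (auto simp: T_def)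
  have colsT: "cols T = ?l" using setl Cc unfolding T_def by (intro cols_mat_of_cols) auto
  have "det T \<noteq> 0"
    using K.NC.det_rank_iff[OF T] K.NC.lin_indpt_full_rank[OF T] colsT dl liC setl by simp
  then obtain S where S: "S \<in> carrier_mat n n" "S * T = 1\<^sub>m n" "T * S = 1\<^sub>m n"
    using det_non_zero_imp_unit[OF T, of "()"] by (auto simp: Units_def ring_mat_def)
  let ?m = "length cs" and ?r = "length ks"
  have mr: "?m + ?r = n" using ll by simp
  have "col T j \<in> mat_kernel N" if "?m \<le> j" "j < n" for j
  proof -
    have "col T j = ?l ! j" using colsT that T by (metis carrier_matD(2) cols_nth)
    also have "\<dots> = ks ! (j - ?m)" using that by (simp add: nth_append)
    also have "\<dots> \<in> set ks" using that ll by (intro nth_mem) auto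
    finally show ?thesis using ks Bker by auto
  qed
  moreover have "\<exists>w \<in> carrier_vec ?r. x = T *\<^sub>v (0\<^sub>v ?m @\<^sub>v w)" if x: "x \<in> mat_kernel N" for x
  proof -
    have "x \<in> K.NC.span (set ks)" using x spB ks by simp
    then have "x \<in> K.NC.span_list ks" using K.NC.span_list_as_span[of ks] ks Bc by simp
    then obtain c where c: "x = K.NC.lincomb_list c ks" by (rule K.NC.in_span_listE)
    have kc: "set ks \<subseteq> carrier_vec n" using ks Bc by simp
    have x1: "x = mat_of_cols n ks *\<^sub>v vec ?r c"
      unfolding c by (intro K.NC.lincomb_list_as_mat_mult) (use kc in auto)
    have "x = T *\<^sub>v (0\<^sub>v ?m @\<^sub>v vec ?r c)"
    proof (rule eq_vecI)
      show "dim_vec x = dim_vec (T *\<^sub>v (0\<^sub>v ?m @\<^sub>v vec ?r c))" using x1 T by simp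
      fix i assume "i < dim_vec (T *\<^sub>v (0\<^sub>v ?m @\<^sub>v vec ?r c))"
      then have i: "i < n" using T by simp
      have rw: "row T i = vec ?m (\<lambda>j. cs ! j $ i) @\<^sub>v vec ?r (\<lambda>j. ks ! j $ i)"
        using i by (intro eq_vecI) (auto simp: T_def mat_of_cols_def nth_append)
      have "(T *\<^sub>v (0\<^sub>v ?m @\<^sub>v vec ?r c)) $ i = vec ?r (\<lambda>j. ks ! j $ i) \<bullet> vec ?r c"
        using i T by (simp add: rw)
          (subst scalar_prod_append[of _ ?m _ ?r], auto)
      also have "vec ?r (\<lambda>j. ks ! j $ i) = row (mat_of_cols n ks) i"
        using i by (intro eq_vecI) (auto simp: mat_of_cols_def)
      finally show "x $ i = (T *\<^sub>v (0\<^sub>v ?m @\<^sub>v vec ?r c)) $ i"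
        using i x1 by simp
    qed
    then show ?thesis by (intro bexI[of _ "vec ?r c"]) auto
  qed
  ultimately show ?thesis using that[OF mr T S(1,3,2)] by blast
qed

section \<open>Block form of a matrix with semisimple eigenvalue one\<close>

text \<open>
  The block condition of the theorem, named because it is the hub of the implications.
\<close>

definition fixed_block_form :: "nat \<Rightarrow> real mat \<Rightarrow> bool" where
  "fixed_block_form n A \<longleftrightarrow>
      (\<exists>(m::nat) (r::nat) (T::real mat) (T_inv::real mat) (A_as::real mat) (A_r::real mat).
         m + r = n \<and> T \<in> carrier_mat n n \<and> T_inv \<in> carrier_mat n n \<and>
         inverts_mat T T_inv \<and> inverts_mat T_inv T \<and>
         A_as \<in> carrier_mat m m \<and> schur_mat A_as \<and> A_r \<in> carrier_mat r m \<and>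
         T_inv * A * T = four_block_mat A_as (0\<^sub>m m r) A_r (1\<^sub>m r))"

text \<open>
  Singularity of \<open>M - I\<close> is a statement about a determinant, hence insensitive to passing from the
  reals to the complex numbers.
\<close>

lemma eigenvalue_of_real_one:
  assumes M: "M \<in> carrier_mat n n" and ev: "eigenvalue (map_mat complex_of_real M) 1"
  shows "eigenvalue M 1"
proof -
  have "char_matrix (map_mat complex_of_real M) 1 = map_mat complex_of_real (char_matrix M 1)"
    using M by (intro eq_matI) (auto simp: char_matrix_def)
  then have "det (map_mat complex_of_real (char_matrix M 1)) = 0"
    using ev M eigenvalue_det[of "map_mat complex_of_real M" n 1] by simp
  then have "det (char_matrix M 1) = 0"
    by (simp add: of_real_hom.hom_det)
  then show ?thesis using eigenvalue_det[OF M] by simp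
qed

text \<open>
  The characteristic determinant of a block triangular matrix factors over the diagonal blocks.
\<close>

lemma eigenvalue_lower_block:
  fixes A1 :: "'a :: field mat"
  assumes c: "A1 \<in> carrier_mat m m" "C \<in> carrier_mat r m" "D \<in> carrier_mat r r"
    and ev: "eigenvalue A1 z"
  shows "eigenvalue (four_block_mat A1 (0\<^sub>m m r) C D) z"
proof -
  have "char_matrix (four_block_mat A1 (0\<^sub>m m r) C D) z
      = four_block_mat (char_matrix A1 z) (0\<^sub>m m r) C (char_matrix D z)"
    using c by (intro eq_matI) (auto simp: char_matrix_def)
  then have "det (char_matrix (four_block_mat A1 (0\<^sub>m m r) C D) z)
      = det (char_matrix A1 z) * det (char_matrix D z)"
    using c by (simp add: det_four_block_mat_upper_right_zero[of _ m _ r])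
  then show ?thesis
    using ev c eigenvalue_det[OF c(1)] eigenvalue_det[of "four_block_mat A1 (0\<^sub>m m r) C D" "m + r"]
    by simp
qed

text \<open>
  Coordinates are chosen such that the last ones span the fixed space of \<open>A\<close>; this forces the right
  block column.  Since \<open>A\<^sup>r\<close> may be arbitrary, any complement of the fixed space will do, and no
  invariant complement has to be constructed.

  Semisimplicity of the eigenvalue 1, which is the first hypothesis on \<open>A\<close>, keeps 1 out of the
  spectrum of \<open>A\<^sup>a\<^sup>s\<close>: a vector \<open>v\<close> fixed by \<open>A\<^sup>a\<^sup>s\<close> gives a vector \<open>x\<close> with first coordinates
  \<open>v\<close> for which \<open>A x - x\<close> is fixed by \<open>A\<close>; then \<open>x\<close> itself is fixed, so its first coordinates
  vanish.  The other eigenvalues of \<open>A\<^sup>a\<^sup>s\<close> are eigenvalues of \<open>A\<close>.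
\<close>

lemma fixed_block_form_if_semisimple:
  fixes A :: "real mat"
  assumes A: "A \<in> carrier_mat n n"
    and ss: "\<And>x. x \<in> carrier_vec n \<Longrightarrow> A *\<^sub>v (A *\<^sub>v x - x) = A *\<^sub>v x - x \<Longrightarrow> A *\<^sub>v x = x"
    and sp: "\<And>z. eigenvalue (map_mat complex_of_real A) z \<Longrightarrow> z \<noteq> 1 \<Longrightarrow> cmod z < 1"
  shows "fixed_block_form n A"
proof -
  have N: "A - 1\<^sub>m n \<in> carrier_mat n n" using A by auto
  have Nx: "(A - 1\<^sub>m n) *\<^sub>v x = A *\<^sub>v x - x" if "x \<in> carrier_vec n" for x
    using A that by (simp add: minus_mult_distrib_mat_vec)
  have kerN: "x \<in> mat_kernel (A - 1\<^sub>m n) \<longleftrightarrow> x \<in> carrier_vec n \<and> A *\<^sub>v x = x" for x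
  proof -
    have "A *\<^sub>v x - x = 0\<^sub>v n \<longleftrightarrow> A *\<^sub>v x = x" if x: "x \<in> carrier_vec n"
    proof
      assume h: "A *\<^sub>v x - x = 0\<^sub>v n"
      have "A *\<^sub>v x = (A *\<^sub>v x - x) + x" using A x by auto
      also have "\<dots> = x" using x by (simp add: h)
      finally show "A *\<^sub>v x = x" .
    qed (use x in auto)
    then show ?thesis using Nx by (auto simp: mat_kernel[OF N])
  qed
  from invertible_extending_kernel_basis[OF N]
  obtain m r T S where mr: "m + r = n" and T: "T \<in> carrier_mat n n" and S: "S \<in> carrier_mat n n"
    and TS: "T * S = 1\<^sub>m n" and ST: "S * T = 1\<^sub>m n"
    and cT: "\<And>j. m \<le> j \<Longrightarrow> j < n \<Longrightarrow> col T j \<in> mat_kernel (A - 1\<^sub>m n)"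
    and kT: "\<And>x. x \<in> mat_kernel (A - 1\<^sub>m n) \<Longrightarrow> \<exists>w \<in> carrier_vec r. x = T *\<^sub>v (0\<^sub>v m @\<^sub>v w)"
    by blast
  define M where "M = S * A * T"
  have M: "M \<in> carrier_mat n n" using S A T by (auto simp: M_def)
  define As where "As = mat m m (\<lambda>(i,j). M $$ (i,j))"
  define Ar where "Ar = mat r m (\<lambda>(i,j). M $$ (m + i,j))"
  have As: "As \<in> carrier_mat m m" and Ar: "Ar \<in> carrier_mat r m" by (auto simp: As_def Ar_def)
  have colM: "col M j = unit_vec n j" if j: "m \<le> j" "j < n" for j
  proof -
    have x: "col T j \<in> carrier_vec n" "A *\<^sub>v col T j = col T j" using cT[OF j] kerN by auto
    have "col M j = (S * A) *\<^sub>v col T j" unfolding M_def by (rule col_mult2[of _ n n _ n]) (use S A T j in auto)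
    also have "\<dots> = S *\<^sub>v col T j" using S A x by (simp add: assoc_mult_mat_vec[of _ n n _ n])
    also have "\<dots> = col (S * T) j" by (rule col_mult2[symmetric, of _ n n _ n]) (use S T j in auto)
    finally show ?thesis using j by (simp add: ST)
  qed
  have blk: "M = four_block_mat As (0\<^sub>m m r) Ar (1\<^sub>m r)"
  proof (rule eq_matI)
    fix i j assume "i < dim_row (four_block_mat As (0\<^sub>m m r) Ar (1\<^sub>m r))"
      "j < dim_col (four_block_mat As (0\<^sub>m m r) Ar (1\<^sub>m r))"
    then have ij: "i < n" "j < n" using As Ar mr by auto
    show "M $$ (i,j) = four_block_mat As (0\<^sub>m m r) Ar (1\<^sub>m r) $$ (i,j)"
    proof (cases "j < m")
      case True
      then show ?thesis using ij mr by (auto simp: As_def Ar_def)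
    next
      case False
      have "M $$ (i,j) = col M j $ i" using M ij by simp
      also have "\<dots> = (if i = j then 1 else 0)" using colM[of j] False ij by simp
      finally show ?thesis using ij mr False by (auto simp: As_def Ar_def)
    qed
  qed (use M As Ar mr in auto)
  have AT: "A *\<^sub>v (T *\<^sub>v y) = T *\<^sub>v (M *\<^sub>v y)" if y: "y \<in> carrier_vec n" for y
  proof -
    have "T * M = (T * S) * A * T" using T S A
      by (simp add: M_def assoc_mult_mat[of _ n n _ n _ n])
    then have "T * M = A * T" using A by (simp add: TS)
    then show ?thesis using assoc_mult_mat_vec[OF A T y] assoc_mult_mat_vec[OF T M y] by simp
  qed
  have STy: "S *\<^sub>v (T *\<^sub>v y) = y" if y: "y \<in> carrier_vec n" for y
    using assoc_mult_mat_vec[OF S T y] y by (simp add: ST)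
  have no1: "\<not> eigenvalue As 1"
  proof
    assume "eigenvalue As 1"
    then obtain v where v: "v \<in> carrier_vec m" "v \<noteq> 0\<^sub>v m" "As *\<^sub>v v = v"
      using As by (auto simp: eigenvalue_def eigenvector_def)
    let ?a = "v @\<^sub>v 0\<^sub>v r" and ?b = "0\<^sub>v m @\<^sub>v (Ar *\<^sub>v v)"
    have Arv: "Ar *\<^sub>v v \<in> carrier_vec r" by (rule mult_mat_vec_carrier[OF Ar v(1)])
    have a: "?a \<in> carrier_vec n" and b: "?b \<in> carrier_vec n" using v(1) Arv mr by auto
    have z: "0\<^sub>m m r *\<^sub>v w = (0\<^sub>v m :: real vec)" if "w \<in> carrier_vec r" for w
      using that by (intro eq_vecI) auto
    have Ma: "M *\<^sub>v ?a = v @\<^sub>v (Ar *\<^sub>v v)"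
      unfolding blk using four_block_mat_mult_vec[OF As zero_carrier_mat Ar one_carrier_mat v(1) zero_carrier_vec]
        v Arv z by simp
    have Mb: "M *\<^sub>v ?b = ?b"
      unfolding blk using four_block_mat_mult_vec[OF As zero_carrier_mat Ar one_carrier_mat zero_carrier_vec Arv]
        mult_mat_zero_vec[OF As] mult_mat_zero_vec[OF Ar] Arv z by simp
    define x where "x = T *\<^sub>v ?a"
    have x: "x \<in> carrier_vec n" using T a by (simp add: x_def)
    have ab: "(v @\<^sub>v (Ar *\<^sub>v v)) - ?a = ?b"
      using v(1) Ar by (intro eq_vecI) auto
    have d: "A *\<^sub>v x - x = T *\<^sub>v ?b"
      unfolding x_def AT[OF a] Ma ab[symmetric]
      by (rule mult_minus_distrib_mat_vec[OF T _ a, symmetric]) (use v(1) Arv mr in auto)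
    have "A *\<^sub>v x = x" by (rule ss[OF x]) (simp add: d AT[OF b] Mb)
    then obtain w where w: "w \<in> carrier_vec r" "x = T *\<^sub>v (0\<^sub>v m @\<^sub>v w)"
      using kT[of x] kerN x by auto
    have "0\<^sub>v m @\<^sub>v w \<in> carrier_vec n"
      using append_carrier_vec[OF zero_carrier_vec w(1), of m] mr by simp
    then have "S *\<^sub>v x = 0\<^sub>v m @\<^sub>v w" unfolding w(2) by (rule STy)
    then have "?a = 0\<^sub>v m @\<^sub>v w" using STy[OF a] by (simp add: x_def)
    then show False using v by (simp add: append_vec_eq[OF v(1) zero_carrier_vec])
  qed
  have "schur_mat As" unfolding schur_mat_def
  proof (intro conjI allI impI)
    show "square_mat As" using As by auto
    fix z assume z: "eigenvalue (map_mat complex_of_real As) z"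
    have "z \<noteq> 1" using eigenvalue_of_real_one[OF As] z no1 by auto
    have "similar_mat M A" unfolding similar_mat_def similar_mat_wit_def
      using M A S T ST TS M_def by (intro exI[of _ S] exI[of _ T]) (simp add: Let_def)
    then have "char_poly (map_mat complex_of_real M) = char_poly (map_mat complex_of_real A)"
      using char_poly_similar[of M A] of_real_hom.char_poly_hom[OF M] of_real_hom.char_poly_hom[OF A]
      by metis
    moreover have "eigenvalue (map_mat complex_of_real M) z"
    proof -
      have map0: "map_mat complex_of_real (0\<^sub>m m r) = 0\<^sub>m m r" by (intro eq_matI) auto
      have "map_mat complex_of_real M = four_block_mat (map_mat complex_of_real As) (0\<^sub>m m r)
          (map_mat complex_of_real Ar) (map_mat complex_of_real (1\<^sub>m r))"
        unfolding blk map_four_block_mat[OF As zero_carrier_mat Ar one_carrier_mat] map0 ..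
      then show ?thesis
        using eigenvalue_lower_block[OF _ _ _ z, of m "map_mat complex_of_real Ar" r
          "map_mat complex_of_real (1\<^sub>m r)"] As Ar by simp
    qed
    ultimately have "eigenvalue (map_mat complex_of_real A) z"
      using M A by (simp add: eigenvalue_root_char_poly[of _ n])
    then show "cmod z < 1" using sp \<open>z \<noteq> 1\<close> by simp
  qed
  moreover have "S * A * T = four_block_mat As (0\<^sub>m m r) Ar (1\<^sub>m r)"
    using blk unfolding M_def .
  moreover have "inverts_mat T S" "inverts_mat S T"
    using T S TS ST by (simp_all add: inverts_mat_def)
  ultimately show ?thesis unfolding fixed_block_form_def
    using mr T S As Ar by blast
qed

section \<open>Norms, powers and trajectories\<close>

lemma pow_mat_Suc_left:
  assumes A: "A \<in> carrier_mat n n"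
  shows "A ^\<^sub>m Suc k = A * A ^\<^sub>m k"
proof (induction k)
  case (Suc k)
  have "A ^\<^sub>m Suc (Suc k) = (A * A ^\<^sub>m k) * A" using Suc.IH by simp
  also have "\<dots> = A * (A ^\<^sub>m k * A)"
    using A by (intro assoc_mult_mat[of _ n n _ n _ n]) auto
  finally show ?case by simp
qed (use A in auto)

lemma trajectory_eq_pow:
  assumes A: "A \<in> carrier_mat n n" and x: "x \<in> carrier_vec n"
  shows "trajectory A x k = A ^\<^sub>m k *\<^sub>v x"
proof (induction k)
  case (Suc k)
  have "A *\<^sub>v (A ^\<^sub>m k *\<^sub>v x) = A ^\<^sub>m Suc k *\<^sub>v x"
    unfolding pow_mat_Suc_left[OF A]
    using A x by (intro assoc_mult_mat_vec[symmetric, of _ n n _ n]) auto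
  then show ?case using Suc.IH by simp
qed (use A x in auto)

lemma trajectory_carrier:
  assumes "A \<in> carrier_mat n n" "x \<in> carrier_vec n"
  shows "trajectory A x k \<in> carrier_vec n"
  using assms by (induction k) auto

lemma vec_norm_eq_L2_set: "vec_norm v = L2_set (($) v) {0..<dim_vec v}"
  by (simp add: vec_norm_def scalar_prod_def L2_set_def power2_eq_square)

lemma vec_norm_nonneg: "vec_norm v \<ge> 0"
  by (simp add: vec_norm_eq_L2_set L2_set_nonneg)

lemma abs_index_le_vec_norm: "i < dim_vec v \<Longrightarrow> \<bar>v $ i\<bar> \<le> vec_norm v"
proof -
  assume i: "i < dim_vec v"
  have "L2_set (\<lambda>i. \<bar>v $ i\<bar>) {0..<dim_vec v} = L2_set (($) v) {0..<dim_vec v}"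
    by (simp add: L2_set_def)
  then show ?thesis
    unfolding vec_norm_eq_L2_set
    using member_le_L2_set[of "{0..<dim_vec v}" i "\<lambda>i. \<bar>v $ i\<bar>"] i by simp
qed

lemma vec_norm_le_sum: "vec_norm v \<le> (\<Sum>i\<in>{0..<dim_vec v}. \<bar>v $ i\<bar>)"
  unfolding vec_norm_eq_L2_set by (rule L2_set_le_sum_abs)

lemma vec_norm_smult: "vec_norm (c \<cdot>\<^sub>v v) = \<bar>c\<bar> * vec_norm v"
  by (simp add: vec_norm_def real_sqrt_mult mult.assoc[symmetric] flip: power2_eq_square)

lemma vec_norm_0_iff: "v \<in> carrier_vec n \<Longrightarrow> vec_norm v = 0 \<longleftrightarrow> v = 0\<^sub>v n"
proof
  assume v: "v \<in> carrier_vec n" and "vec_norm v = 0"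
  then have "v $ i = 0" if "i < n" for i using abs_index_le_vec_norm[of i v] that by auto
  with v show "v = 0\<^sub>v n" by (intro eq_vecI) auto
qed (simp add: vec_norm_def)

text \<open>
  Limits of vectors are taken coordinatewise below; this is the bridge to the norm.
\<close>

lemma vec_norm_diff_tendsto_iff:
  assumes X: "\<And>k. X k \<in> carrier_vec n" and x: "x \<in> carrier_vec n"
  shows "(\<lambda>k. vec_norm (X k - x)) \<longlonglongrightarrow> 0 \<longleftrightarrow> (\<forall>i<n. (\<lambda>k. X k $ i) \<longlonglongrightarrow> x $ i)"
proof (intro iffI allI impI)
  fix i assume l: "(\<lambda>k. vec_norm (X k - x)) \<longlonglongrightarrow> 0" and i: "i < n"
  have "\<bar>X k $ i - x $ i\<bar> \<le> vec_norm (X k - x)" for k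
    using abs_index_le_vec_norm[of i "X k - x"] i X[of k] x by simp
  then have "(\<lambda>k. X k $ i - x $ i) \<longlonglongrightarrow> 0"
    by (intro tendsto_rabs_zero_cancel[OF tendsto_sandwich[OF _ _ tendsto_const l]]) auto
  then show "(\<lambda>k. X k $ i) \<longlonglongrightarrow> x $ i" by (rule LIM_zero_cancel)
next
  assume l: "\<forall>i<n. (\<lambda>k. X k $ i) \<longlonglongrightarrow> x $ i"
  have "(\<lambda>k. \<Sum>i\<in>{0..<n}. \<bar>X k $ i - x $ i\<bar>) \<longlonglongrightarrow> (\<Sum>i\<in>{0..<n}. 0)"
    using l by (intro tendsto_sum tendsto_rabs_zero LIM_zero) auto
  then have s0: "(\<lambda>k. \<Sum>i\<in>{0..<n}. \<bar>X k $ i - x $ i\<bar>) \<longlonglongrightarrow> 0" by simp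
  have "vec_norm (X k - x) \<le> (\<Sum>i\<in>{0..<n}. \<bar>X k $ i - x $ i\<bar>)" for k
    using vec_norm_le_sum[of "X k - x"] X[of k] x by simp
  then show "(\<lambda>k. vec_norm (X k - x)) \<longlonglongrightarrow> 0"
    by (intro tendsto_sandwich[OF _ _ tendsto_const s0]) (auto simp: vec_norm_nonneg)
qed

lemma tendsto_mult_mat_vec_index:
  fixes X :: "nat \<Rightarrow> real mat"
  assumes X: "\<And>k. X k \<in> carrier_mat n n" "L \<in> carrier_mat n n" and v: "v \<in> carrier_vec n"
    and lim: "\<And>j. j < n \<Longrightarrow> (\<lambda>k. X k $$ (i, j)) \<longlonglongrightarrow> L $$ (i, j)" and i: "i < n"
  shows "(\<lambda>k. (X k *\<^sub>v v) $ i) \<longlonglongrightarrow> (L *\<^sub>v v) $ i"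
proof -
  have "(Y *\<^sub>v v) $ i = (\<Sum>j\<in>{0..<n}. Y $$ (i, j) * v $ j)" if "Y \<in> carrier_mat n n" for Y :: "real mat"
    using that v i by (auto simp: scalar_prod_def)
  then show ?thesis using X lim by (auto intro!: tendsto_intros)
qed

lemma convergent_systemI:
  assumes A: "A \<in> carrier_mat n n" and L: "L \<in> carrier_mat n n"
    and lim: "\<And>i j. i < n \<Longrightarrow> j < n \<Longrightarrow> (\<lambda>k. (A ^\<^sub>m k) $$ (i, j)) \<longlonglongrightarrow> L $$ (i, j)"
  shows "convergent_system n A"
  unfolding convergent_system_def
proof (intro ballI)
  fix x :: "real vec" assume x: "x \<in> carrier_vec n"
  have "\<forall>i<n. (\<lambda>k. (A ^\<^sub>m k *\<^sub>v x) $ i) \<longlonglongrightarrow> (L *\<^sub>v x) $ i"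
    using A L x lim by (auto intro!: tendsto_mult_mat_vec_index simp del: index_mult_mat_vec)
  then have "(\<lambda>k. vec_norm (trajectory A x k - L *\<^sub>v x)) \<longlonglongrightarrow> 0"
    using vec_norm_diff_tendsto_iff[of "trajectory A x" n "L *\<^sub>v x"] trajectory_carrier[OF A x] L x
    by (simp add: trajectory_eq_pow[OF A x] del: index_mult_mat_vec)
  then show "\<exists>xbar\<in>carrier_vec n. (\<lambda>k. vec_norm (trajectory A x k - xbar)) \<longlonglongrightarrow> 0"
    using L x by (intro bexI[of _ "L *\<^sub>v x"]) auto
qed

section \<open>Geometric convergence of the powers\<close>

lemma norm_bound_index:
  fixes M :: "real mat"
  assumes "norm_bound M b" "M \<in> carrier_mat nr nc" "i < nr" "j < nc"
  shows "\<bar>M $$ (i,j)\<bar> \<le> b"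
  using assms by (auto simp: norm_bound_def)

lemma smult_pow_mat:
  fixes M :: "'a :: comm_ring_1 mat"
  assumes M: "M \<in> carrier_mat n n"
  shows "(c \<cdot>\<^sub>m M) ^\<^sub>m k = c ^ k \<cdot>\<^sub>m M ^\<^sub>m k"
proof (induction k)
  case (Suc k)
  have "(c ^ k \<cdot>\<^sub>m M ^\<^sub>m k) * (c \<cdot>\<^sub>m M) = c ^ Suc k \<cdot>\<^sub>m (M ^\<^sub>m k * M)"
    using M by (intro eq_matI) (auto simp: scalar_prod_def sum_distrib_left mult_ac)
  then show ?case by (simp add: Suc.IH)
qed (use M in auto)

text \<open>
  Dividing \<open>M\<close> by a number \<open>\<rho>\<close> strictly between its spectral radius and 1 leaves the spectral radius
  below 1, so the powers of the quotient are bounded; multiplying back yields the rate \<open>\<rho>\<close>.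
\<close>

lemma schur_powers_geometric:
  assumes M: "M \<in> carrier_mat m m" and schur: "schur_mat M"
  obtains c \<rho> where "0 < \<rho>" "\<rho> < 1" "c \<ge> 0" "\<And>k. norm_bound (M ^\<^sub>m k) (c * \<rho> ^ k)"
proof (cases "m = 0")
  \<comment> \<open>the spectral radius is the maximum of an empty set here\<close>
  case True
  then have "norm_bound (M ^\<^sub>m k) (0 * (1/2) ^ k)" for k
    using M by (auto simp: norm_bound_def)
  then show ?thesis using that[of "1/2" 0] by simp
next
  case False
  define B where "B = map_mat complex_of_real M"
  have B: "B \<in> carrier_mat m m" using M by (simp add: B_def)
  note mem = spectral_radius_mem_max[OF B]
  have r: "0 \<le> spectral_radius B" "spectral_radius B < 1"
    using mem(1) False schur by (auto simp: schur_mat_def B_def spectrum_def)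
  define \<rho> where "\<rho> = (1 + spectral_radius B) / 2"
  have \<rho>: "0 < \<rho>" "\<rho> < 1" "spectral_radius B < \<rho>" using r by (auto simp: \<rho>_def)
  define z where "z = complex_of_real (1 / \<rho>)"
  have zB: "z \<cdot>\<^sub>m B \<in> carrier_mat m m" using B by simp
  have "cmod a < 1" if a: "eigenvalue (z \<cdot>\<^sub>m B) a" for a
  proof -
    obtain v where v: "v \<in> carrier_vec m" "v \<noteq> 0\<^sub>v m" "(z \<cdot>\<^sub>m B) *\<^sub>v v = a \<cdot>\<^sub>v v"
      using a B by (auto simp: eigenvalue_def eigenvector_def)
    have "B *\<^sub>v v = complex_of_real \<rho> \<cdot>\<^sub>v ((z \<cdot>\<^sub>m B) *\<^sub>v v)"
      using B v(1) \<rho>(1) by (intro eq_vecI) (auto simp: z_def)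
    then have "eigenvalue B (complex_of_real \<rho> * a)"
      using v B by (auto simp: eigenvalue_def eigenvector_def smult_smult_assoc intro!: exI[of _ v])
    then have "cmod (complex_of_real \<rho> * a) \<le> spectral_radius B"
      using mem(2) False by (auto simp: spectrum_def)
    then have "\<rho> * cmod a \<le> spectral_radius B" using \<rho> by (simp add: norm_mult)
    moreover have "\<rho> * 1 \<le> \<rho> * cmod a" if "\<not> cmod a < 1"
      using that \<rho>(1) by (intro mult_left_mono) auto
    ultimately show ?thesis using \<rho>(3) by linarith
  qed
  then have "spectral_radius (z \<cdot>\<^sub>m B) < 1"
    using spectral_radius_mem_max(1)[OF zB] False by (auto simp: spectrum_def)
  then obtain c where c: "\<And>k. norm_bound ((z \<cdot>\<^sub>m B) ^\<^sub>m k) c"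
    using spectral_radius_jnf_norm_bound_less_1_upper_triangular[OF zB] by auto
  have "norm_bound (M ^\<^sub>m k) (max c 0 * \<rho> ^ k)" for k
  proof
    fix i j assume "i < dim_row (M ^\<^sub>m k)" "j < dim_col (M ^\<^sub>m k)"
    then have ij: "i < m" "j < m" using M by (auto split: if_splits)
    have Bk: "B ^\<^sub>m k = map_mat complex_of_real (M ^\<^sub>m k)"
      unfolding B_def by (rule of_real_hom.mat_hom_pow[OF M, symmetric])
    have "cmod (((z \<cdot>\<^sub>m B) ^\<^sub>m k) $$ (i,j)) \<le> c"
      using c[of k] ij B by (auto simp: norm_bound_def)
    moreover have "((z \<cdot>\<^sub>m B) ^\<^sub>m k) $$ (i,j) = complex_of_real ((1 / \<rho>) ^ k * (M ^\<^sub>m k) $$ (i,j))"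
      unfolding smult_pow_mat[OF B] Bk using ij M by (simp add: z_def)
    ultimately have "\<bar>(1 / \<rho>) ^ k * (M ^\<^sub>m k) $$ (i,j)\<bar> \<le> c" by (simp only: norm_of_real)
    then have "\<bar>(M ^\<^sub>m k) $$ (i,j)\<bar> / \<rho> ^ k \<le> c"
      using \<rho>(1) by (simp add: abs_mult power_divide)
    then have "\<bar>(M ^\<^sub>m k) $$ (i,j)\<bar> \<le> c * \<rho> ^ k"
      using \<rho>(1) by (simp add: pos_divide_le_eq)
    also have "\<dots> \<le> max c 0 * \<rho> ^ k" using \<rho>(1) by (intro mult_right_mono) auto
    finally show "norm ((M ^\<^sub>m k) $$ (i,j)) \<le> max c 0 * \<rho> ^ k" by simp
  qed
  then show ?thesis using that[of \<rho> "max c 0"] \<rho> by auto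
qed

text \<open>
  The tails of the geometric series bound the distance between any two later terms, uniformly, and the
  bound survives in the limit.
\<close>

lemma geometric_increments_limit:
  fixes u :: "nat \<Rightarrow> real"
  assumes \<rho>: "0 < \<rho>" "\<rho> < 1" and u: "\<And>k. \<bar>u (Suc k) - u k\<bar> \<le> b * \<rho> ^ k"
  obtains l where "\<And>k. \<bar>u k - l\<bar> \<le> b / (1 - \<rho>) * \<rho> ^ k"
proof -
  have inc: "\<bar>u (k + j) - u k\<bar> \<le> b / (1 - \<rho>) * (\<rho> ^ k - \<rho> ^ (k + j))" for k j
  proof (induction j)
    case (Suc j)
    have "\<bar>u (k + Suc j) - u k\<bar> \<le> b * \<rho> ^ (k + j) + b / (1 - \<rho>) * (\<rho> ^ k - \<rho> ^ (k + j))"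
      using Suc.IH u[of "k + j"] by simp
    also have "\<dots> = b / (1 - \<rho>) * (\<rho> ^ k - \<rho> ^ (k + Suc j))"
      using \<rho> by (simp add: field_simps)
    finally show ?case .
  qed simp
  have "summable (\<lambda>k. b * \<rho> ^ k)"
    using \<rho> by (intro summable_mult summable_geometric) auto
  then have "summable (\<lambda>k. u (Suc k) - u k)"
    using u by (intro summable_comparison_test[of "\<lambda>k. u (Suc k) - u k" "\<lambda>k. b * \<rho> ^ k"]) auto
  then have "convergent (\<lambda>k. \<Sum>i<k. u (Suc i) - u i)"
    by (simp add: summable_iff_convergent)
  then have "convergent (\<lambda>k. u k - u 0)" by (simp add: sum_lessThan_telescope)
  then have "convergent (\<lambda>k. (u k - u 0) + u 0)"
    by (intro convergent_add convergent_const)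
  then obtain l where l: "u \<longlonglongrightarrow> l" by (auto simp: convergent_def)
  have b: "b \<ge> 0" using u[of 0] by simp
  have "\<bar>u k - l\<bar> \<le> b / (1 - \<rho>) * \<rho> ^ k" for k
  proof (rule LIMSEQ_le_const2)
    show "(\<lambda>j. \<bar>u k - u (j + k)\<bar>) \<longlonglongrightarrow> \<bar>u k - l\<bar>"
      by (intro tendsto_intros LIMSEQ_ignore_initial_segment l)
    have "\<bar>u k - u (j + k)\<bar> \<le> b / (1 - \<rho>) * \<rho> ^ k" for j
    proof -
      have "b / (1 - \<rho>) * (\<rho> ^ k - \<rho> ^ (k + j)) \<le> b / (1 - \<rho>) * \<rho> ^ k"
        using b \<rho> by (intro mult_left_mono) auto
      then show ?thesis using inc[of k j] by (simp add: add.commute abs_minus_commute)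
    qed
    then show "\<exists>N. \<forall>j\<ge>N. \<bar>u k - u (j + k)\<bar> \<le> b / (1 - \<rho>) * \<rho> ^ k" by blast
  qed
  then show ?thesis using that by blast
qed

lemma geometric_bound_tendsto:
  fixes u :: "nat \<Rightarrow> real"
  assumes \<rho>: "0 < \<rho>" "\<rho> < 1" and u: "\<And>k. \<bar>u k - l\<bar> \<le> c * \<rho> ^ k"
  shows "u \<longlonglongrightarrow> l"
proof -
  have "(\<lambda>k. c * \<rho> ^ k) \<longlonglongrightarrow> c * 0"
    using \<rho> by (intro tendsto_mult tendsto_const LIMSEQ_power_zero) auto
  then have z: "(\<lambda>k. c * \<rho> ^ k) \<longlonglongrightarrow> 0" by simp
  have "(\<lambda>k. u k - l) \<longlonglongrightarrow> 0"
    by (intro tendsto_rabs_zero_cancel[OF tendsto_sandwich[OF _ _ tendsto_const z]]) (use u in auto)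
  then show ?thesis by (rule LIM_zero_cancel)
qed

lemma tendsto_mult_mat_index:
  fixes X :: "nat \<Rightarrow> real mat"
  assumes X: "\<And>k. X k \<in> carrier_mat n n" "L \<in> carrier_mat n n"
    and Y: "\<And>k. Y k \<in> carrier_mat n n" "K \<in> carrier_mat n n"
    and lX: "\<And>i j. i < n \<Longrightarrow> j < n \<Longrightarrow> (\<lambda>k. X k $$ (i,j)) \<longlonglongrightarrow> L $$ (i,j)"
    and lY: "\<And>i j. i < n \<Longrightarrow> j < n \<Longrightarrow> (\<lambda>k. Y k $$ (i,j)) \<longlonglongrightarrow> K $$ (i,j)"
    and ij: "i < n" "j < n"
  shows "(\<lambda>k. (X k * Y k) $$ (i,j)) \<longlonglongrightarrow> (L * K) $$ (i,j)"
proof -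
  have e: "(P * Q) $$ (i,j) = (\<Sum>l\<in>{0..<n}. P $$ (i,l) * Q $$ (l,j))"
    if "P \<in> carrier_mat n n" "Q \<in> carrier_mat n n" for P Q :: "real mat"
    using that ij by (auto simp: scalar_prod_def)
  show ?thesis unfolding e[OF X(1) Y(1)] e[OF X(2) Y(2)]
    using lX lY ij by (auto intro!: tendsto_intros)
qed

text \<open>
  The same \<open>D\<close> occurs in both equations, so it cancels in the difference of consecutive powers.  Only
  powers of the Schur block remain there.
\<close>

lemma lower_block_pow:
  fixes A1 :: "'a :: comm_ring_1 mat"
  assumes c: "A1 \<in> carrier_mat m m" "C \<in> carrier_mat r m"
  shows "\<exists>D \<in> carrier_mat r m. (four_block_mat A1 (0\<^sub>m m r) C (1\<^sub>m r)) ^\<^sub>m k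
      = four_block_mat (A1 ^\<^sub>m k) (0\<^sub>m m r) D (1\<^sub>m r) \<and>
    (four_block_mat A1 (0\<^sub>m m r) C (1\<^sub>m r)) ^\<^sub>m Suc k
      = four_block_mat (A1 ^\<^sub>m Suc k) (0\<^sub>m m r) (C * A1 ^\<^sub>m k + D) (1\<^sub>m r)"
proof -
  let ?M = "four_block_mat A1 (0\<^sub>m m r) C (1\<^sub>m r)"
  have M: "?M \<in> carrier_mat (m + r) (m + r)" using c by simp
  have step: "?M ^\<^sub>m Suc k = four_block_mat (A1 ^\<^sub>m Suc k) (0\<^sub>m m r) (C * A1 ^\<^sub>m k + D) (1\<^sub>m r)"
    if D: "D \<in> carrier_mat r m" and e: "?M ^\<^sub>m k = four_block_mat (A1 ^\<^sub>m k) (0\<^sub>m m r) D (1\<^sub>m r)" for k D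
  proof -
    have P: "A1 ^\<^sub>m k \<in> carrier_mat m m" using c by simp
    have "C * A1 ^\<^sub>m k + D \<in> carrier_mat r m" using c P D by simp
    moreover have "A1 * A1 ^\<^sub>m k \<in> carrier_mat m m" using c P by simp
    ultimately show ?thesis
      unfolding pow_mat_Suc_left[OF M] pow_mat_Suc_left[OF c(1)] e
      unfolding mult_four_block_mat[OF c(1) zero_carrier_mat c(2) one_carrier_mat
          P zero_carrier_mat D one_carrier_mat]
      using c P D by simp
  qed
  have "\<exists>D \<in> carrier_mat r m. ?M ^\<^sub>m k = four_block_mat (A1 ^\<^sub>m k) (0\<^sub>m m r) D (1\<^sub>m r)"
  proof (induction k)
    case 0
    show ?case using c by (intro bexI[of _ "0\<^sub>m r m"]) auto
  next
    case (Suc k)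
    then obtain D where D: "D \<in> carrier_mat r m" "?M ^\<^sub>m k = four_block_mat (A1 ^\<^sub>m k) (0\<^sub>m m r) D (1\<^sub>m r)"
      by blast
    have "C * A1 ^\<^sub>m k + D \<in> carrier_mat r m" using c D by simp
    with step[OF D] show ?case by blast
  qed
  with step show ?thesis by blast
qed

text \<open>
  In the adapted coordinates the increment \<open>M\<^sup>k\<^sup>+\<^sup>1 - M\<^sup>k\<close> has the blocks
  \<open>A\<^sub>1\<^sup>k\<^sup>+\<^sup>1 - A\<^sub>1\<^sup>k\<close> and \<open>A\<^sup>r A\<^sub>1\<^sup>k\<close> in its left column, where \<open>A\<^sub>1 = A\<^sup>a\<^sup>s\<close>, and zeros in its right
  one.  It decays geometrically, and so does its conjugate \<open>A\<^sup>k\<^sup>+\<^sup>1 - A\<^sup>k\<close>.  The algebraic identities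
  for the limit follow by letting \<open>k\<close> tend to infinity in \<open>A A\<^sup>k = A\<^sup>k A = A\<^sup>k\<^sup>+\<^sup>1\<close> and in
  \<open>A\<^sup>k L = L\<close>.
\<close>

lemma fixed_block_form_pow_limit:
  assumes A: "A \<in> carrier_mat n n" and d: "fixed_block_form n A"
  obtains L \<rho> c where "L \<in> carrier_mat n n" "0 < \<rho>" "\<rho> < 1" "c \<ge> 0"
    "A * L = L" "L * A = L" "L * L = L" "\<And>k. norm_bound (A ^\<^sub>m k - L) (c * \<rho> ^ k)"
proof -
  obtain m r T S As Ar where mr: "m + r = n" and T: "T \<in> carrier_mat n n"
    and S: "S \<in> carrier_mat n n" and inv: "inverts_mat T S" "inverts_mat S T"
    and As: "As \<in> carrier_mat m m" and sch: "schur_mat As" and Ar: "Ar \<in> carrier_mat r m"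
    and eq: "S * A * T = four_block_mat As (0\<^sub>m m r) Ar (1\<^sub>m r)"
    using d unfolding fixed_block_form_def by blast
  define M where "M = four_block_mat As (0\<^sub>m m r) Ar (1\<^sub>m r)"
  have M: "M \<in> carrier_mat n n" using As Ar mr by (auto simp: M_def)
  have TS: "T * S = 1\<^sub>m n" and ST: "S * T = 1\<^sub>m n" using inv T S by (auto simp: inverts_mat_def)
  have "T * M * S = (T * S) * A * (T * S)"
    unfolding M_def eq[symmetric] using T S A by (simp add: assoc_mult_mat[of _ n n _ n _ n])
  then have "A = T * M * S" using A by (simp add: TS)
  then have wit: "similar_mat_wit A M T S"
    using A M T S TS ST by (auto simp: similar_mat_wit_def)
  obtain c0 \<rho> where \<rho>: "0 < \<rho>" "\<rho> < 1" and c0: "c0 \<ge> 0"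
    and nb: "\<And>k. norm_bound (As ^\<^sub>m k) (c0 * \<rho> ^ k)"
    using schur_powers_geometric[OF As sch] by metis
  obtain a0 where a0: "norm_bound Ar a0" using norm_bound_max by blast
  define a where "a = max a0 0"
  have a: "a \<ge> 0" "norm_bound Ar a" using a0 by (auto simp: a_def norm_bound_def le_max_iff_disj)
  define c1 where "c1 = 2 * c0 + a * c0 * real m"
  have c1: "c1 \<ge> 0" using c0 a by (simp add: c1_def)
  have incM: "norm_bound (M ^\<^sub>m Suc k - M ^\<^sub>m k) (c1 * \<rho> ^ k)" for k
  proof -
    have P: "As ^\<^sub>m k \<in> carrier_mat m m" "As ^\<^sub>m Suc k \<in> carrier_mat m m" using As by auto
    obtain D where D: "D \<in> carrier_mat r m" "M ^\<^sub>m k = four_block_mat (As ^\<^sub>m k) (0\<^sub>m m r) D (1\<^sub>m r)"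
      "M ^\<^sub>m Suc k = four_block_mat (As ^\<^sub>m Suc k) (0\<^sub>m m r) (Ar * As ^\<^sub>m k + D) (1\<^sub>m r)"
      using lower_block_pow[OF As Ar, of k] unfolding M_def by blast
    have "norm_bound (Ar * As ^\<^sub>m k) (a * (c0 * \<rho> ^ k) * real m)"
      using norm_bound_mult[OF Ar P(1) a(2) nb] .
    then have b1: "\<bar>(Ar * As ^\<^sub>m k) $$ (i,j)\<bar> \<le> a * c0 * real m * \<rho> ^ k" if "i < r" "j < m" for i j
      using norm_bound_index[of "Ar * As ^\<^sub>m k", OF _ mult_carrier_mat[OF Ar P(1)] that]
      by (simp add: mult_ac)
    have b2: "\<bar>(As ^\<^sub>m k) $$ (i,j)\<bar> \<le> c0 * \<rho> ^ k" if "i < m" "j < m" for i j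
      by (rule norm_bound_index[OF nb P(1) that])
    have b3: "\<bar>(As ^\<^sub>m Suc k) $$ (i,j)\<bar> \<le> c0 * \<rho> ^ k" if "i < m" "j < m" for i j
    proof -
      have "\<bar>(As ^\<^sub>m Suc k) $$ (i,j)\<bar> \<le> c0 * \<rho> ^ Suc k"
        by (rule norm_bound_index[OF nb P(2) that])
      also have "\<dots> \<le> c0 * \<rho> ^ k"
        using c0 \<rho> by (intro mult_left_mono power_decreasing) auto
      finally show ?thesis .
    qed
    have pos: "a * c0 * real m * \<rho> ^ k \<ge> 0" "c0 * \<rho> ^ k \<ge> 0" using a c0 \<rho> by auto
    show ?thesis
    proof
      fix i j assume "i < dim_row (M ^\<^sub>m Suc k - M ^\<^sub>m k)" "j < dim_col (M ^\<^sub>m Suc k - M ^\<^sub>m k)"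
      then have ij: "i < n" "j < n" using M by (auto split: if_splits)
      have e: "c1 * \<rho> ^ k = 2 * (c0 * \<rho> ^ k) + a * c0 * real m * \<rho> ^ k"
        by (simp add: c1_def algebra_simps)
      have fb: "four_block_mat X (0\<^sub>m m r) Y (1\<^sub>m r) $$ (i,j) = (if i < m
          then (if j < m then X $$ (i,j) else 0)
          else (if j < m then Y $$ (i - m,j) else if i = j then 1 else 0))"
        if "X \<in> carrier_mat m m" "Y \<in> carrier_mat r m" for X Y :: "real mat"
        using that ij mr by auto
      have Y: "Ar * As ^\<^sub>m k + D \<in> carrier_mat r m" using D(1) by simp
      have d: "(M ^\<^sub>m Suc k - M ^\<^sub>m k) $$ (i,j) = (M ^\<^sub>m Suc k) $$ (i,j) - (M ^\<^sub>m k) $$ (i,j)"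
        by (rule index_minus_mat(1)) (use ij M in \<open>auto split: if_splits\<close>)
      have s: "(Ar * As ^\<^sub>m k + D) $$ (i - m, j) = (Ar * As ^\<^sub>m k) $$ (i - m, j) + D $$ (i - m, j)"
        if "\<not> i < m" "j < m"
        by (rule index_add_mat(1)) (use that ij mr D(1) in auto)
      consider "i < m" "j < m" | "\<not> i < m" "j < m" | "\<not> j < m" by blast
      then show "norm ((M ^\<^sub>m Suc k - M ^\<^sub>m k) $$ (i,j)) \<le> c1 * \<rho> ^ k"
      proof cases
        case 1
        then show ?thesis unfolding d e unfolding D(2,3) fb[OF P(1) D(1)] fb[OF P(2) Y]
          using b2[of i j] b3[of i j] pos unfolding real_norm_def if_P[OF 1(1)] if_P[OF 1(2)]
          by linarith
      next
        case 2
        then have "i - m < r" using ij mr by auto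
        then show ?thesis unfolding d e unfolding D(2,3) fb[OF P(1) D(1)] fb[OF P(2) Y]
          using b1[of "i - m" j] s[OF 2] pos 2 by simp
      next
        case 3
        then show ?thesis unfolding d e unfolding D(2,3) fb[OF P(1) D(1)] fb[OF P(2) Y]
          using pos by simp
      qed
    qed
  qed
  obtain t0 s0 where ts: "norm_bound T t0" "norm_bound S s0" using norm_bound_max by blast
  define b where "b = t0 * c1 * real n * s0 * real n"
  have Ak: "A ^\<^sub>m k \<in> carrier_mat n n" for k using A by auto
  have incA: "norm_bound (A ^\<^sub>m Suc k - A ^\<^sub>m k) (b * \<rho> ^ k)" for k
  proof -
    have Mk: "M ^\<^sub>m k \<in> carrier_mat n n" "M ^\<^sub>m Suc k \<in> carrier_mat n n" using M by auto
    have Dc: "M ^\<^sub>m Suc k - M ^\<^sub>m k \<in> carrier_mat n n" by (rule minus_carrier_mat[OF Mk(1)])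
    have "A ^\<^sub>m Suc k - A ^\<^sub>m k = T * (M ^\<^sub>m Suc k - M ^\<^sub>m k) * S"
      unfolding similar_mat_wit_pow_id[OF wit] using T S Mk
      by (simp add: minus_mult_distrib_mat[of _ n n _ _ n] mult_minus_distrib_mat[of _ n n _ n] del: pow_mat.simps)
    moreover have "norm_bound (T * (M ^\<^sub>m Suc k - M ^\<^sub>m k) * S) (t0 * (c1 * \<rho> ^ k) * real n * s0 * real n)"
      using norm_bound_mult[OF mult_carrier_mat[OF T Dc] S norm_bound_mult[OF T Dc ts(1) incM] ts(2)] .
    ultimately show ?thesis by (simp add: b_def mult_ac del: pow_mat.simps)
  qed
  have "\<exists>l. \<forall>k. \<bar>(A ^\<^sub>m k) $$ (i,j) - l\<bar> \<le> b / (1 - \<rho>) * \<rho> ^ k" if ij: "i < n" "j < n" for i j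
  proof -
    have "\<bar>(A ^\<^sub>m Suc k) $$ (i,j) - (A ^\<^sub>m k) $$ (i,j)\<bar> \<le> b * \<rho> ^ k" for k
    proof -
      have "(A ^\<^sub>m Suc k - A ^\<^sub>m k) $$ (i,j) = (A ^\<^sub>m Suc k) $$ (i,j) - (A ^\<^sub>m k) $$ (i,j)"
        by (rule index_minus_mat(1)) (use ij A in \<open>auto split: if_splits\<close>)
      then show ?thesis
        using norm_bound_index[OF incA[of k] minus_carrier_mat[OF Ak] ij] by simp
    qed
    then show ?thesis using geometric_increments_limit[OF \<rho>, of "\<lambda>k. (A ^\<^sub>m k) $$ (i,j)" b] by metis
  qed
  then obtain l where l: "\<And>i j k. i < n \<Longrightarrow> j < n \<Longrightarrow> \<bar>(A ^\<^sub>m k) $$ (i,j) - l i j\<bar> \<le> b / (1 - \<rho>) * \<rho> ^ k"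
    by metis
  define c where "c = max (b / (1 - \<rho>)) 0"
  define L where "L = mat n n (\<lambda>(i,j). l i j)"
  have L: "L \<in> carrier_mat n n" by (simp add: L_def)
  have bd: "\<bar>(A ^\<^sub>m k) $$ (i,j) - L $$ (i,j)\<bar> \<le> c * \<rho> ^ k" if ij: "i < n" "j < n" for i j k
  proof -
    have "b / (1 - \<rho>) * \<rho> ^ k \<le> c * \<rho> ^ k" using \<rho> by (intro mult_right_mono) (auto simp: c_def)
    then show ?thesis using l[OF ij, of k] ij by (simp add: L_def)
  qed
  have lim: "(\<lambda>k. (A ^\<^sub>m k) $$ (i,j)) \<longlonglongrightarrow> L $$ (i,j)" if ij: "i < n" "j < n" for i j
    by (rule geometric_bound_tendsto[OF \<rho> bd[OF ij]])
  have limS: "(\<lambda>k. (A ^\<^sub>m Suc k) $$ (i,j)) \<longlonglongrightarrow> L $$ (i,j)" if "i < n" "j < n" for i j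
    using LIMSEQ_Suc[OF lim[OF that]] .
  have AL: "A * L = L"
  proof (rule eq_matI)
    fix i j assume "i < dim_row L" "j < dim_col L"
    then have ij: "i < n" "j < n" using L by auto
    have "(\<lambda>k. (A * A ^\<^sub>m k) $$ (i,j)) \<longlonglongrightarrow> (A * L) $$ (i,j)"
      using A Ak L lim ij by (intro tendsto_mult_mat_index) auto
    then show "(A * L) $$ (i,j) = L $$ (i,j)"
      using limS[OF ij] unfolding pow_mat_Suc_left[OF A] by (rule LIMSEQ_unique)
  qed (use A L in auto)
  have LA: "L * A = L"
  proof (rule eq_matI)
    fix i j assume "i < dim_row L" "j < dim_col L"
    then have ij: "i < n" "j < n" using L by auto
    have "(\<lambda>k. (A ^\<^sub>m k * A) $$ (i,j)) \<longlonglongrightarrow> (L * A) $$ (i,j)"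
      using A Ak L lim ij by (intro tendsto_mult_mat_index) auto
    then show "(L * A) $$ (i,j) = L $$ (i,j)"
      using limS[OF ij] unfolding pow_mat.simps by (rule LIMSEQ_unique)
  qed (use A L in auto)
  have AkL: "A ^\<^sub>m k * L = L" for k
  proof (induction k)
    case (Suc k)
    have "A ^\<^sub>m Suc k * L = A ^\<^sub>m k * (A * L)"
      unfolding pow_mat.simps using A Ak L by (intro assoc_mult_mat[of _ n n _ n _ n]) auto
    then show ?case by (simp only: AL Suc.IH)
  qed (use A L in auto)
  have LL: "L * L = L"
  proof (rule eq_matI)
    fix i j assume "i < dim_row L" "j < dim_col L"
    then have ij: "i < n" "j < n" using L by auto
    have "(\<lambda>k. (A ^\<^sub>m k * L) $$ (i,j)) \<longlonglongrightarrow> (L * L) $$ (i,j)"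
      using Ak L lim ij by (intro tendsto_mult_mat_index) auto
    then show "(L * L) $$ (i,j) = L $$ (i,j)" unfolding AkL by (rule LIMSEQ_unique[OF _ tendsto_const])
  qed (use A L in auto)
  have "norm_bound (A ^\<^sub>m k - L) (c * \<rho> ^ k)" for k
    using bd[of _ _ k] A L by (auto simp: norm_bound_def)
  moreover have "c \<ge> 0" by (simp add: c_def)
  ultimately show ?thesis using that[OF L \<rho> _ AL LA LL] by blast
qed

section \<open>Quadratic forms\<close>

abbreviation quad_form :: "real mat \<Rightarrow> real vec \<Rightarrow> real" where
  "quad_form P x \<equiv> x \<bullet> (P *\<^sub>v x)"

lemma smult_mat_mult_vec:
  fixes P :: "'a :: comm_ring_1 mat"
  assumes "P \<in> carrier_mat n n" "x \<in> carrier_vec n"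
  shows "(c \<cdot>\<^sub>m P) *\<^sub>v x = c \<cdot>\<^sub>v (P *\<^sub>v x)"
  using assms by (intro eq_vecI) auto

lemma A_dt_vec:
  assumes A: "A \<in> carrier_mat n n" and x: "x \<in> carrier_vec n"
  shows "A_dt n A \<eta> *\<^sub>v x = (1 / \<eta>) \<cdot>\<^sub>v (A *\<^sub>v x) - ((1 - \<eta>) / \<eta>) \<cdot>\<^sub>v x"
proof -
  have c: "(1 / \<eta>) \<cdot>\<^sub>m A \<in> carrier_mat n n" "((1 - \<eta>) / \<eta>) \<cdot>\<^sub>m 1\<^sub>m n \<in> carrier_mat n n"
    using A by auto
  show ?thesis unfolding A_dt_def minus_mult_distrib_mat_vec[OF c x] smult_mat_mult_vec[OF A x]
    smult_mat_mult_vec[OF one_carrier_mat x] using x by simp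
qed

lemma A_dt_carrier: "A_dt n A \<eta> \<in> carrier_mat n n"
  unfolding A_dt_def by (rule minus_carrier_mat) simp

lemma one_smult_mat: "(1 :: 'a :: monoid_mult) \<cdot>\<^sub>m M = M"
  by (intro eq_matI) auto

lemma vec_norm_power2: "(vec_norm v)\<^sup>2 = v \<bullet> v"
  by (simp add: vec_norm_def scalar_prod_def sum_nonneg)

lemma vec_norm_diff_power2:
  assumes "u \<in> carrier_vec n" "v \<in> carrier_vec n"
  shows "(vec_norm (u - v))\<^sup>2 \<le> 2 * (vec_norm u)\<^sup>2 + 2 * (vec_norm v)\<^sup>2"
proof -
  have "(\<Sum>i\<in>{0..<n}. (u $ i - v $ i) * (u $ i - v $ i))
      \<le> (\<Sum>i\<in>{0..<n}. 2 * (u $ i * u $ i) + 2 * (v $ i * v $ i))"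
  proof (rule sum_mono)
    fix i
    have "0 \<le> (u $ i + v $ i)\<^sup>2" by simp
    then show "(u $ i - v $ i) * (u $ i - v $ i) \<le> 2 * (u $ i * u $ i) + 2 * (v $ i * v $ i)"
      by (simp add: power2_eq_square algebra_simps)
  qed
  then show ?thesis using assms
    by (simp add: vec_norm_power2 scalar_prod_def sum.distrib sum_distrib_left)
qed

lemma quad_form_congruence:
  assumes "B \<in> carrier_mat n n" "P \<in> carrier_mat n n" "x \<in> carrier_vec n"
  shows "quad_form (B\<^sup>T * P * B) x = quad_form P (B *\<^sub>v x)"
proof -
  have c: "B\<^sup>T \<in> carrier_mat n n" "B *\<^sub>v x \<in> carrier_vec n" "P *\<^sub>v (B *\<^sub>v x) \<in> carrier_vec n"
    "B\<^sup>T * P \<in> carrier_mat n n"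
    using assms by (auto intro!: mult_mat_vec_carrier)
  have "(B\<^sup>T * P * B) *\<^sub>v x = B\<^sup>T *\<^sub>v (P *\<^sub>v (B *\<^sub>v x))"
    by (simp only: assoc_mult_mat_vec[OF c(4) assms(1,3)] assoc_mult_mat_vec[OF c(1) assms(2) c(2)])
  moreover have "B\<^sup>T *\<^sub>v (P *\<^sub>v (B *\<^sub>v x)) \<in> carrier_vec n"
    by (rule mult_mat_vec_carrier[OF c(1,3)])
  ultimately show ?thesis
    using transpose_vec_mult_scalar[OF assms(1,3) c(3)] comm_scalar_prod[OF assms(3)]
      comm_scalar_prod[OF c(2,3)] by metis
qed

lemma transpose_congruence:
  assumes "B \<in> carrier_mat n n" "P \<in> carrier_mat n n" "P\<^sup>T = P"
  shows "(B\<^sup>T * P * B)\<^sup>T = B\<^sup>T * P * (B :: real mat)"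
proof -
  have "(B\<^sup>T * P * B)\<^sup>T = B\<^sup>T * (B\<^sup>T * P)\<^sup>T"
    using assms by (intro transpose_mult) auto
  also have "(B\<^sup>T * P)\<^sup>T = P\<^sup>T * (B\<^sup>T)\<^sup>T"
    using assms by (intro transpose_mult) auto
  finally show ?thesis using assms by (simp add: assoc_mult_mat[of _ n n _ n _ n])
qed

text \<open>
  Both matrix inequalities of the theorem have this shape.  Reading them as inequalities between values
  of quadratic forms turns them into statements about Lyapunov functions.
\<close>

lemma neg_semidef_lyapunov_iff:
  fixes A P Q :: "real mat"
  assumes A: "A \<in> carrier_mat n n" and P: "P \<in> carrier_mat n n" "P\<^sup>T = P"
    and Q: "Q \<in> carrier_mat n n" "Q\<^sup>T = Q"
  shows "neg_semidef_mat n (a \<cdot>\<^sub>m (A\<^sup>T * P * A - P)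
            + b \<cdot>\<^sub>m ((A\<^sup>T - 1\<^sub>m n) * Q * (A - 1\<^sub>m n)))
    \<longleftrightarrow> (\<forall>x \<in> carrier_vec n. a * (quad_form P (A *\<^sub>v x) - quad_form P x)
            + b * quad_form Q (A *\<^sub>v x - x) \<le> 0)"
proof -
  let ?X = "A\<^sup>T * P * A" and ?Y = "(A\<^sup>T - 1\<^sub>m n) * Q * (A - 1\<^sub>m n)"
  let ?M = "a \<cdot>\<^sub>m (?X - P) + b \<cdot>\<^sub>m ?Y"
  have N: "A - 1\<^sub>m n \<in> carrier_mat n n" using A by auto
  have NT: "A\<^sup>T - 1\<^sub>m n = (A - 1\<^sub>m n)\<^sup>T" using A by (intro eq_matI) auto
  have X: "?X \<in> carrier_mat n n" and Y: "?Y \<in> carrier_mat n n" using A P Q by auto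
  have XP': "?X - P \<in> carrier_mat n n" using X P by auto
  then have XP: "a \<cdot>\<^sub>m (?X - P) \<in> carrier_mat n n" by simp
  have bY: "b \<cdot>\<^sub>m ?Y \<in> carrier_mat n n" using Y by simp
  have M: "?M \<in> carrier_mat n n" using XP bY by simp
  have XT: "?X\<^sup>T = ?X" by (rule transpose_congruence[OF A P])
  have YT: "?Y\<^sup>T = ?Y" unfolding NT by (rule transpose_congruence[OF N Q])
  have sym: "(- ?M)\<^sup>T = - ?M"
  proof (rule eq_matI)
    fix i j assume "i < dim_row (- ?M)" "j < dim_col (- ?M)"
    then have ij: "i < n" "j < n" using M by auto
    have s: "Z $$ (j,i) = Z $$ (i,j)" if "Z\<^sup>T = Z" "Z \<in> carrier_mat n n" for Z :: "real mat"
      using that ij by (metis carrier_matD index_transpose_mat(1))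
    have "(- ?M) $$ (k,l) = - (a * (?X $$ (k,l) - P $$ (k,l)) + b * ?Y $$ (k,l))" if "k < n" "l < n" for k l
      using that carrier_matD[OF X] carrier_matD[OF Y] carrier_matD[OF P(1)]
      by (simp del: index_mult_mat(1))
    then show "(- ?M)\<^sup>T $$ (i,j) = (- ?M) $$ (i,j)"
      using ij carrier_matD[OF M] s[OF XT X] s[OF YT Y] s[OF P(2,1)]
      by (simp del: index_mult_mat(1) index_uminus_mat(1))
  qed (use M in auto)
  have "quad_form (- ?M) x = - (a * (quad_form P (A *\<^sub>v x) - quad_form P x)
            + b * quad_form Q (A *\<^sub>v x - x))" if x: "x \<in> carrier_vec n" for x
  proof -
    have c: "?X *\<^sub>v x \<in> carrier_vec n" "?Y *\<^sub>v x \<in> carrier_vec n" "P *\<^sub>v x \<in> carrier_vec n"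
      using X Y P x by (auto intro!: mult_mat_vec_carrier)
    have "(- ?M) *\<^sub>v x = - (?M *\<^sub>v x)" using M x by (intro uminus_mult_mat_vec) auto
    also have "?M *\<^sub>v x = a \<cdot>\<^sub>v (?X *\<^sub>v x - P *\<^sub>v x) + b \<cdot>\<^sub>v (?Y *\<^sub>v x)"
      unfolding add_mult_distrib_mat_vec[OF XP bY x] smult_mat_mult_vec[OF XP' x]
        smult_mat_mult_vec[OF Y x] minus_mult_distrib_mat_vec[OF X P(1) x] ..
    finally have e: "(- ?M) *\<^sub>v x = - (a \<cdot>\<^sub>v (?X *\<^sub>v x - P *\<^sub>v x) + b \<cdot>\<^sub>v (?Y *\<^sub>v x))" .
    have "quad_form (- ?M) x = - (a * (quad_form ?X x - quad_form P x) + b * quad_form ?Y x)"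
      unfolding e using c x
      by (simp add: scalar_prod_add_distrib[of _ n] scalar_prod_minus_distrib[of _ n])
    moreover have "(A - 1\<^sub>m n) *\<^sub>v x = A *\<^sub>v x - x"
      using A x by (simp add: minus_mult_distrib_mat_vec)
    ultimately show ?thesis
      unfolding NT quad_form_congruence[OF A P(1) x] quad_form_congruence[OF N Q(1) x] by simp
  qed
  then show ?thesis unfolding neg_semidef_mat_def pos_semidef_mat_def using M sym by auto
qed

lemma quad_form_add:
  assumes "P \<in> carrier_mat n n" "Q \<in> carrier_mat n n" "x \<in> carrier_vec n"
  shows "quad_form (P + Q) x = quad_form P x + quad_form Q x"
proof -
  have "P *\<^sub>v x \<in> carrier_vec n" "Q *\<^sub>v x \<in> carrier_vec n"
    using assms by (auto intro!: mult_mat_vec_carrier)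
  then show ?thesis
    using assms by (simp add: add_mult_distrib_mat_vec[of _ n n] scalar_prod_add_distrib[of _ n])
qed

lemma quad_form_smult:
  assumes "P \<in> carrier_mat n n" "x \<in> carrier_vec n"
  shows "quad_form (c \<cdot>\<^sub>m P) x = c * quad_form P x"
proof -
  have "P *\<^sub>v x \<in> carrier_vec n" using assms by (rule mult_mat_vec_carrier)
  then show ?thesis using assms(2) by (simp add: smult_mat_mult_vec[OF assms])
qed

text \<open>
  The kernel is recorded alongside the values of the quadratic form, because it determines the rank
  of \<open>P\<close>.
\<close>

lemma gram_sum_exists:
  fixes M :: "nat \<Rightarrow> real mat"
  assumes M: "\<And>j. M j \<in> carrier_mat n n"
  shows "\<exists>P \<in> carrier_mat n n. P\<^sup>T = P
    \<and> (\<forall>x \<in> carrier_vec n. quad_form P x = (\<Sum>j<N. w j * (vec_norm (M j *\<^sub>v x))\<^sup>2))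
    \<and> (\<forall>x \<in> carrier_vec n. (\<forall>j<N. M j *\<^sub>v x = 0\<^sub>v n) \<longrightarrow> P *\<^sub>v x = 0\<^sub>v n)"
proof (induction N)
  case 0
  have "0\<^sub>m n n *\<^sub>v x = 0\<^sub>v n" if "x \<in> carrier_vec n" for x :: "real vec"
    using that by (intro eq_vecI) auto
  then show ?case by (intro bexI[of _ "0\<^sub>m n n"]) auto
next
  case (Suc N)
  then obtain P where P: "P \<in> carrier_mat n n" "P\<^sup>T = P"
    and q: "\<And>x. x \<in> carrier_vec n \<Longrightarrow> quad_form P x = (\<Sum>j<N. w j * (vec_norm (M j *\<^sub>v x))\<^sup>2)"
    and k: "\<And>x. x \<in> carrier_vec n \<Longrightarrow> (\<forall>j<N. M j *\<^sub>v x = 0\<^sub>v n) \<Longrightarrow> P *\<^sub>v x = 0\<^sub>v n" by blast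
  \<comment> \<open>the identity in the middle makes this an instance of a congruence\<close>
  let ?G = "(M N)\<^sup>T * 1\<^sub>m n * M N"
  have G: "?G \<in> carrier_mat n n" using M[of N] by auto
  have GT: "?G\<^sup>T = ?G" by (rule transpose_congruence[OF M]) auto
  let ?P = "P + w N \<cdot>\<^sub>m ?G"
  have wG: "w N \<cdot>\<^sub>m ?G \<in> carrier_mat n n" using G by simp
  have wGT: "(w N \<cdot>\<^sub>m ?G)\<^sup>T = w N \<cdot>\<^sub>m ?G\<^sup>T" using G by (intro eq_matI) auto
  show ?case
  proof (intro bexI[of _ ?P] conjI ballI impI)
    show "?P \<in> carrier_mat n n" using P wG by simp
    show "?P\<^sup>T = ?P" unfolding transpose_add[OF P(1) wG] wGT GT P(2) ..
    fix x :: "real vec" assume x: "x \<in> carrier_vec n"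
    have Mx: "M N *\<^sub>v x \<in> carrier_vec n" using M x by (rule mult_mat_vec_carrier)
    have "quad_form ?G x = (vec_norm (M N *\<^sub>v x))\<^sup>2"
      using quad_form_congruence[OF M _ x, of "1\<^sub>m n" N] Mx by (simp add: vec_norm_power2)
    then show "quad_form ?P x = (\<Sum>j<Suc N. w j * (vec_norm (M j *\<^sub>v x))\<^sup>2)"
      using quad_form_add[OF P(1) wG x] quad_form_smult[OF G x] q[OF x] by simp
    assume z: "\<forall>j<Suc N. M j *\<^sub>v x = 0\<^sub>v n"
    have "?G *\<^sub>v x = ((M N)\<^sup>T * 1\<^sub>m n) *\<^sub>v (M N *\<^sub>v x)"
      using M[of N] x by (intro assoc_mult_mat_vec[of _ n n _ n]) auto
    also have "\<dots> = 0\<^sub>v n" using z M[of N] by (intro eq_vecI) auto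
    finally have "(w N \<cdot>\<^sub>m ?G) *\<^sub>v x = 0\<^sub>v n"
      unfolding smult_mat_mult_vec[OF G x] by (auto intro: eq_vecI)
    then show "?P *\<^sub>v x = 0\<^sub>v n"
      using add_mult_distrib_mat_vec[OF P(1) wG x] k[OF x] z by simp
  qed
qed

section \<open>Lyapunov functions built from the limit projection\<close>

text \<open>
  The situation reached from the block form: \<open>L\<close> is the limit of the powers of \<open>A\<close>, a projection
  onto the fixed vectors.  The number \<open>N\<close> is a horizon at which the deviation \<open>A\<^sup>N - L\<close> has
  beaten the rate \<open>\<rho>\<close>, in the maximum norm (used for the polyhedral function) and in the Euclidean norm
  (used for the quadratic ones).  Sums and maxima over \<open>j < N\<close> can then replace infinite ones.
\<close>

locale limit_projection =
  fixes n :: nat and A L :: "real mat" and \<rho> :: real and N :: nat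
  assumes A: "A \<in> carrier_mat n n" and L: "L \<in> carrier_mat n n"
    and AL: "A * L = L" and LA: "L * A = L" and LL: "L * L = L"
    and \<rho>: "0 < \<rho>" "\<rho> < 1" and N: "0 < N"
    and max_contr: "\<And>y b. y \<in> carrier_vec n \<Longrightarrow> (\<And>i. i < n \<Longrightarrow> \<bar>y $ i\<bar> \<le> b) \<Longrightarrow>
      i < n \<Longrightarrow> \<bar>((A ^\<^sub>m N - L) *\<^sub>v y) $ i\<bar> \<le> \<rho> ^ N * b"
    and norm_contr: "\<And>y. y \<in> carrier_vec n \<Longrightarrow>
      vec_norm ((A ^\<^sub>m N - L) *\<^sub>v y) \<le> \<rho> ^ N * vec_norm y"
begin

definition D :: "nat \<Rightarrow> real mat" where "D j = A ^\<^sub>m j - L"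

lemma pow_carrier: "A ^\<^sub>m j \<in> carrier_mat n n" using A by simp

lemma D_carrier: "D j \<in> carrier_mat n n"
  unfolding D_def by (rule minus_carrier_mat[OF L])

lemma D_vec: "x \<in> carrier_vec n \<Longrightarrow> D j *\<^sub>v x = A ^\<^sub>m j *\<^sub>v x - L *\<^sub>v x"
  unfolding D_def by (rule minus_mult_distrib_mat_vec[OF pow_carrier L])

lemma vec_carriers:
  assumes "x \<in> carrier_vec n"
  shows "A *\<^sub>v x \<in> carrier_vec n" "L *\<^sub>v x \<in> carrier_vec n" "D j *\<^sub>v x \<in> carrier_vec n"
    "A ^\<^sub>m j *\<^sub>v x \<in> carrier_vec n"
  using assms by (auto intro!: mult_mat_vec_carrier A L D_carrier pow_carrier)

lemma L_A: "x \<in> carrier_vec n \<Longrightarrow> L *\<^sub>v (A *\<^sub>v x) = L *\<^sub>v x"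
  using assoc_mult_mat_vec[OF L A] LA by metis

lemma A_L: "x \<in> carrier_vec n \<Longrightarrow> A *\<^sub>v (L *\<^sub>v x) = L *\<^sub>v x"
  using assoc_mult_mat_vec[OF A L] AL by metis

lemma L_L: "x \<in> carrier_vec n \<Longrightarrow> L *\<^sub>v (L *\<^sub>v x) = L *\<^sub>v x"
  using assoc_mult_mat_vec[OF L L] LL by metis

lemma pow_L: "x \<in> carrier_vec n \<Longrightarrow> A ^\<^sub>m j *\<^sub>v (L *\<^sub>v x) = L *\<^sub>v x"
proof (induction j)
  case (Suc j)
  have "A ^\<^sub>m Suc j *\<^sub>v (L *\<^sub>v x) = A ^\<^sub>m j *\<^sub>v (A *\<^sub>v (L *\<^sub>v x))"
    unfolding pow_mat.simps by (rule assoc_mult_mat_vec[OF pow_carrier A vec_carriers(2)[OF Suc.prems]])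
  then show ?case using Suc by (simp only: A_L)
qed (use A L in auto)

text \<open>
  One step of the system shifts the sequence of deviations; all contraction estimates come from this.
\<close>

lemma D_A: "x \<in> carrier_vec n \<Longrightarrow> D j *\<^sub>v (A *\<^sub>v x) = D (Suc j) *\<^sub>v x"
  by (simp only: D_vec vec_carriers L_A pow_mat.simps assoc_mult_mat_vec[OF pow_carrier A])

lemma D_0: "x \<in> carrier_vec n \<Longrightarrow> D 0 *\<^sub>v x = x - L *\<^sub>v x"
  using D_vec[of x 0] A by simp

text \<open>
  Deviations vanish on the fixed vectors \<open>L x\<close> and so only see the component \<open>D\<^sub>0 x = x - L x\<close>.
\<close>

lemma D_D0: "x \<in> carrier_vec n \<Longrightarrow> D j *\<^sub>v (D 0 *\<^sub>v x) = D j *\<^sub>v x"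
proof -
  assume x: "x \<in> carrier_vec n"
  note c = vec_carriers[OF x]
  have "D j *\<^sub>v (L *\<^sub>v x) = 0\<^sub>v n"
    unfolding D_vec[OF c(2)] pow_L[OF x] L_L[OF x] using c(2) by auto
  then show ?thesis
    unfolding D_0[OF x] mult_minus_distrib_mat_vec[OF D_carrier x c(2)] using c(3) by auto
qed

lemma D_max_contr:
  assumes x: "x \<in> carrier_vec n" and b: "\<And>i. i < n \<Longrightarrow> \<bar>(D 0 *\<^sub>v x) $ i\<bar> \<le> b" and i: "i < n"
  shows "\<bar>(D N *\<^sub>v x) $ i\<bar> \<le> \<rho> ^ N * b"
  using max_contr[OF vec_carriers(3)[OF x, of 0] b i] D_D0[OF x, of N] unfolding D_def by simp

lemma D_norm_contr:
  assumes x: "x \<in> carrier_vec n"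
  shows "vec_norm (D N *\<^sub>v x) \<le> \<rho> ^ N * vec_norm (D 0 *\<^sub>v x)"
  using norm_contr[OF vec_carriers(3)[OF x, of 0]] D_D0[OF x, of N] unfolding D_def by simp

lemma D_0_zero_iff:
  assumes x: "x \<in> carrier_vec n"
  shows "D 0 *\<^sub>v x = 0\<^sub>v n \<longleftrightarrow> x = L *\<^sub>v x"
proof
  assume "D 0 *\<^sub>v x = 0\<^sub>v n"
  then have "x - L *\<^sub>v x = 0\<^sub>v n" using D_0[OF x] by simp
  moreover have "x = (x - L *\<^sub>v x) + L *\<^sub>v x"
    using x L by (intro eq_vecI) auto
  ultimately show "x = L *\<^sub>v x" using vec_carriers(2)[OF x] by (metis left_zero_vec)
next
  assume h: "x = L *\<^sub>v x"
  have "D 0 *\<^sub>v x = x - x" using D_0[OF x] h by simp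
  then show "D 0 *\<^sub>v x = 0\<^sub>v n" using x by simp
qed

text \<open>
  If \<open>A x = x\<close>, all deviations of \<open>x\<close> agree; as the one at the horizon is a proper contraction of
  the initial one, they are zero.
\<close>

lemma fixed_iff:
  assumes x: "x \<in> carrier_vec n"
  shows "A *\<^sub>v x = x \<longleftrightarrow> L *\<^sub>v x = x"
proof
  assume h: "A *\<^sub>v x = x"
  have D: "D j *\<^sub>v x = D 0 *\<^sub>v x" for j
    by (induction j) (use D_A[OF x] h in auto)
  have "vec_norm (D 0 *\<^sub>v x) \<le> \<rho> ^ N * vec_norm (D 0 *\<^sub>v x)"
    using D_norm_contr[OF x] D[of N] by simp
  moreover have "\<rho> ^ N < 1" using \<rho> N by (simp add: power_less_one_iff)
  ultimately have "vec_norm (D 0 *\<^sub>v x) = 0"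
    using vec_norm_nonneg[of "D 0 *\<^sub>v x"] mult_right_mono[of "\<rho> ^ N" 1 "vec_norm (D 0 *\<^sub>v x)"]
    by (smt (verit) mult_less_cancel_right2)
  then show "L *\<^sub>v x = x"
    using vec_norm_0_iff[OF vec_carriers(3)[OF x]] D_0_zero_iff[OF x] by simp
next
  assume "L *\<^sub>v x = x"
  then show "A *\<^sub>v x = x" using A_L[OF x] by simp
qed

definition U :: "real vec \<Rightarrow> real" where
  "U x = (\<Sum>j<N. (1 / \<rho>\<^sup>2) ^ j * (vec_norm (D j *\<^sub>v x))\<^sup>2)"

lemma U_nonneg: "U x \<ge> 0"
  unfolding U_def using \<rho> by (intro sum_nonneg mult_nonneg_nonneg) auto

lemma U_eq_0D:
  assumes x: "x \<in> carrier_vec n" and "U x = 0"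
  shows "x = L *\<^sub>v x"
proof -
  have "\<forall>j\<in>{..<N}. (1 / \<rho>\<^sup>2) ^ j * (vec_norm (D j *\<^sub>v x))\<^sup>2 = 0"
    using assms(2) \<rho> unfolding U_def
    by (subst (asm) sum_nonneg_eq_0_iff) (auto intro!: mult_nonneg_nonneg)
  then have "vec_norm (D 0 *\<^sub>v x) = 0" using N by force
  then show ?thesis using vec_norm_0_iff[OF vec_carriers(3)[OF x]] D_0_zero_iff[OF x] by simp
qed

text \<open>
  By the shift property, \<open>U (A x) / \<rho>\<^sup>2\<close> is the defining sum of \<open>U x\<close> moved by one index: it loses the
  term at 0 and gains the term at \<open>N\<close>, which is the smaller one by the choice of the horizon.
\<close>

lemma U_A_le:
  assumes x: "x \<in> carrier_vec n"
  shows "U (A *\<^sub>v x) \<le> \<rho>\<^sup>2 * U x"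
proof -
  define a where "a j = (1 / \<rho>\<^sup>2) ^ j * (vec_norm (D j *\<^sub>v x))\<^sup>2" for j
  have e: "U (A *\<^sub>v x) = \<rho>\<^sup>2 * (\<Sum>j<N. a (Suc j))"
    unfolding U_def a_def D_A[OF x] sum_distrib_left using \<rho>
    by (intro sum.cong) (auto simp: field_simps)
  have "a N \<le> a 0"
  proof -
    have "(vec_norm (D N *\<^sub>v x))\<^sup>2 \<le> (\<rho> ^ N * vec_norm (D 0 *\<^sub>v x))\<^sup>2"
      by (intro power_mono D_norm_contr x vec_norm_nonneg)
    then show ?thesis using \<rho>
      by (simp add: a_def power_mult_distrib power_divide divide_le_eq power2_eq_square mult_ac)
  qed
  moreover have "(\<Sum>j<N. a (Suc j)) = (\<Sum>j<N. a j) + a N - a 0"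
    by (induction N) auto
  ultimately have "(\<Sum>j<N. a (Suc j)) \<le> U x" by (simp add: U_def a_def)
  then show ?thesis unfolding e using \<rho> by (intro mult_left_mono) auto
qed

text \<open>
  Any constant would do in place of 4; it only enters the choice of \<open>\<eta>\<close> and \<open>Q\<close> below.
\<close>

lemma U_diff_le:
  assumes x: "x \<in> carrier_vec n"
  shows "U (A *\<^sub>v x - x) \<le> 4 * U x"
proof -
  have "U (A *\<^sub>v x - x) \<le> (\<Sum>j<N. (1 / \<rho>\<^sup>2) ^ j *
      (2 * (vec_norm (D j *\<^sub>v (A *\<^sub>v x)))\<^sup>2 + 2 * (vec_norm (D j *\<^sub>v x))\<^sup>2))"
    unfolding U_def mult_minus_distrib_mat_vec[OF D_carrier vec_carriers(1)[OF x] x] using \<rho>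
    by (intro sum_mono mult_left_mono vec_norm_diff_power2[where n = n] vec_carriers x) auto
  also have "\<dots> = 2 * U (A *\<^sub>v x) + 2 * U x"
    by (simp add: U_def sum.distrib sum_distrib_left algebra_simps)
  also have "\<dots> \<le> 4 * U x"
  proof -
    have "\<rho>\<^sup>2 * U x \<le> 1 * U x"
      using \<rho> U_nonneg by (intro mult_right_mono) (auto simp: power_le_one)
    then show ?thesis using U_A_le[OF x] by simp
  qed
  finally show ?thesis .
qed

text \<open>
  The form \<open>P\<^sub>0\<close> with values \<open>U\<close> decreases by at least \<open>(1 - \<rho>\<^sup>2) U\<close> in one step, and so does the form \<open>P\<close> with values
  \<open>U x + |L x|\<^sup>2\<close>, whose value at \<open>A x - x\<close> is at most \<open>4 U x\<close>.  Hence \<open>P\<close> proves the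
  inequality in \<open>\<eta>\<close>, and the pair of \<open>P\<^sub>0\<close> with a small multiple \<open>Q\<close> of \<open>P\<close> proves the other one.  The
  kernel of \<open>P\<^sub>0\<close> is the fixed space of \<open>A\<close>, which gives its rank.
\<close>

lemma quadratic_certificate:
  obtains \<eta> P Q P0 where "0 < \<eta>" "\<eta> < 1" "pos_def_mat n P"
    "neg_semidef_mat n (\<eta> \<cdot>\<^sub>m (A\<^sup>T * P * A - P) + (1 - \<eta>) \<cdot>\<^sub>m ((A\<^sup>T - 1\<^sub>m n) * P * (A - 1\<^sub>m n)))"
    "pos_def_mat n Q" "pos_semidef_mat n P0"
    "vec_space.rank n P0 = n - kernel_dim (A - 1\<^sub>m n)"
    "neg_semidef_mat n (A\<^sup>T * P0 * A - P0 + (A\<^sup>T - 1\<^sub>m n) * Q * (A - 1\<^sub>m n))"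
proof -
  obtain P0 where P0: "P0 \<in> carrier_mat n n" "P0\<^sup>T = P0"
    and q0: "\<And>x. x \<in> carrier_vec n \<Longrightarrow> quad_form P0 x = U x"
    and k0: "\<And>x. x \<in> carrier_vec n \<Longrightarrow> (\<forall>j<N. D j *\<^sub>v x = 0\<^sub>v n) \<Longrightarrow> P0 *\<^sub>v x = 0\<^sub>v n"
    using gram_sum_exists[where M = D and n = n and N = N and w = "\<lambda>j. (1 / \<rho>\<^sup>2) ^ j", OF D_carrier]
    unfolding U_def by blast
  obtain G where G: "G \<in> carrier_mat n n" "G\<^sup>T = G"
    and qG: "\<And>x. x \<in> carrier_vec n \<Longrightarrow> quad_form G x = (vec_norm (L *\<^sub>v x))\<^sup>2"
    using gram_sum_exists[where M = "\<lambda>_. L" and n = n and N = 1 and w = "\<lambda>_. 1", OF L] by auto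
  define P where "P = P0 + G"
  have P: "P \<in> carrier_mat n n" "P\<^sup>T = P"
    using P0 G by (auto simp: P_def transpose_add[OF P0(1) G(1)])
  have q: "quad_form P x = U x + (vec_norm (L *\<^sub>v x))\<^sup>2" if x: "x \<in> carrier_vec n" for x
    unfolding P_def quad_form_add[OF P0(1) G(1) x] q0[OF x] qG[OF x] ..
  have pd: "quad_form P x > 0" if x: "x \<in> carrier_vec n" "x \<noteq> 0\<^sub>v n" for x
  proof (rule ccontr)
    assume "\<not> quad_form P x > 0"
    then have "U x + (vec_norm (L *\<^sub>v x))\<^sup>2 \<le> 0" using q[OF x(1)] by simp
    moreover have "U x \<ge> 0" "(vec_norm (L *\<^sub>v x))\<^sup>2 \<ge> 0" by (rule U_nonneg) simp
    ultimately have "U x = 0" "(vec_norm (L *\<^sub>v x))\<^sup>2 = 0" by linarith+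
    then have "x = L *\<^sub>v x" "vec_norm (L *\<^sub>v x) = 0" using U_eq_0D[OF x(1)] by auto
    then show False using vec_norm_0_iff[OF x(1)] x(2) by simp
  qed
  have Ax: "A *\<^sub>v x \<in> carrier_vec n" "A *\<^sub>v x - x \<in> carrier_vec n" if "x \<in> carrier_vec n" for x
    using vec_carriers(1)[OF that] that by auto
  have Ldiff: "L *\<^sub>v (A *\<^sub>v x - x) = 0\<^sub>v n" if x: "x \<in> carrier_vec n" for x
    unfolding mult_minus_distrib_mat_vec[OF L Ax(1)[OF x] x] L_A[OF x] using vec_carriers(2)[OF x] by simp
  have qA: "quad_form P (A *\<^sub>v x) - quad_form P x \<le> - (1 - \<rho>\<^sup>2) * U x"
    and q0A: "quad_form P0 (A *\<^sub>v x) - quad_form P0 x \<le> - (1 - \<rho>\<^sup>2) * U x"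
    and qd: "quad_form P (A *\<^sub>v x - x) \<le> 4 * U x" if x: "x \<in> carrier_vec n" for x
    unfolding q[OF x] q[OF Ax(1)[OF x]] q[OF Ax(2)[OF x]] q0[OF x] q0[OF Ax(1)[OF x]] L_A[OF x] Ldiff[OF x]
    using U_A_le[OF x] U_diff_le[OF x] vec_norm_0_iff[of "0\<^sub>v n" n] by (auto simp: algebra_simps)
  have \<delta>: "\<rho>\<^sup>2 < 1" using \<rho> by (simp add: power_less_one_iff)
  \<comment> \<open>chosen such that the gain \<open>4 (1 - \<eta>) U\<close> is exactly paid for by the loss \<open>\<eta> (1 - \<rho>\<^sup>2) U\<close>\<close>
  define \<eta> where "\<eta> = 4 / (4 + (1 - \<rho>\<^sup>2))"
  have \<eta>: "0 < \<eta>" "\<eta> < 1" using \<delta> by (auto simp: \<eta>_def)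
  have \<eta>4: "(1 - \<eta>) * 4 = \<eta> * (1 - \<rho>\<^sup>2)"
    using \<delta> by (simp add: \<eta>_def field_simps)
  have PP: "pos_def_mat n P" using P pd by (auto simp: pos_def_mat_def)
  have e: "neg_semidef_mat n (\<eta> \<cdot>\<^sub>m (A\<^sup>T * P * A - P) + (1 - \<eta>) \<cdot>\<^sub>m ((A\<^sup>T - 1\<^sub>m n) * P * (A - 1\<^sub>m n)))"
    unfolding neg_semidef_lyapunov_iff[OF A P P]
  proof
    fix x :: "real vec" assume x: "x \<in> carrier_vec n"
    have "\<eta> * (quad_form P (A *\<^sub>v x) - quad_form P x) \<le> \<eta> * (- (1 - \<rho>\<^sup>2) * U x)"
      using qA[OF x] \<eta> by (intro mult_left_mono) auto
    moreover have "(1 - \<eta>) * quad_form P (A *\<^sub>v x - x) \<le> (1 - \<eta>) * (4 * U x)"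
      using qd[OF x] \<eta> by (intro mult_left_mono) auto
    moreover have "(1 - \<eta>) * (4 * U x) = \<eta> * (1 - \<rho>\<^sup>2) * U x" using \<eta>4 by (metis mult.assoc)
    ultimately show "\<eta> * (quad_form P (A *\<^sub>v x) - quad_form P x) + (1 - \<eta>) * quad_form P (A *\<^sub>v x - x) \<le> 0"
      by (simp add: algebra_simps)
  qed
  define Q where "Q = ((1 - \<rho>\<^sup>2) / 4) \<cdot>\<^sub>m P"
  have Q: "Q \<in> carrier_mat n n" using P by (simp add: Q_def)
  have QT: "Q\<^sup>T = Q"
  proof -
    have "Q\<^sup>T = ((1 - \<rho>\<^sup>2) / 4) \<cdot>\<^sub>m P\<^sup>T" using P(1) by (intro eq_matI) (auto simp: Q_def)
    then show ?thesis by (simp only: P(2) Q_def)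
  qed
  have qQ: "quad_form Q x = (1 - \<rho>\<^sup>2) / 4 * quad_form P x" if "x \<in> carrier_vec n" for x
    unfolding Q_def by (rule quad_form_smult[OF P(1) that])
  have QQ: "pos_def_mat n Q" using Q QT pd \<delta> by (auto simp: pos_def_mat_def qQ)
  have "neg_semidef_mat n (1 \<cdot>\<^sub>m (A\<^sup>T * P0 * A - P0) + 1 \<cdot>\<^sub>m ((A\<^sup>T - 1\<^sub>m n) * Q * (A - 1\<^sub>m n)))"
    unfolding neg_semidef_lyapunov_iff[OF A P0 Q QT]
  proof
    fix x :: "real vec" assume x: "x \<in> carrier_vec n"
    have "(1 - \<rho>\<^sup>2) / 4 * quad_form P (A *\<^sub>v x - x) \<le> (1 - \<rho>\<^sup>2) / 4 * (4 * U x)"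
      using qd[OF x] \<delta> by (intro mult_left_mono) auto
    then have "quad_form Q (A *\<^sub>v x - x) \<le> (1 - \<rho>\<^sup>2) * U x"
      unfolding qQ[OF Ax(2)[OF x]] by simp
    moreover have "quad_form P0 (A *\<^sub>v x) - quad_form P0 x \<le> - ((1 - \<rho>\<^sup>2) * U x)"
      using q0A[OF x] by (simp only: minus_mult_left)
    ultimately show "1 * (quad_form P0 (A *\<^sub>v x) - quad_form P0 x) + 1 * quad_form Q (A *\<^sub>v x - x) \<le> 0"
      unfolding mult_1 by linarith
  qed
  then have f: "neg_semidef_mat n (A\<^sup>T * P0 * A - P0 + (A\<^sup>T - 1\<^sub>m n) * Q * (A - 1\<^sub>m n))"
    by (simp only: one_smult_mat)
  have PP0: "pos_semidef_mat n P0" using P0 q0 U_nonneg by (auto simp: pos_semidef_mat_def)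
  have AI: "A - 1\<^sub>m n \<in> carrier_mat n n" by (rule minus_carrier_mat) simp
  have "x \<in> mat_kernel P0 \<longleftrightarrow> x \<in> mat_kernel (A - 1\<^sub>m n)" if x: "x \<in> carrier_vec n" for x
  proof -
    have "P0 *\<^sub>v x = 0\<^sub>v n \<longleftrightarrow> L *\<^sub>v x = x"
    proof
      assume "P0 *\<^sub>v x = 0\<^sub>v n"
      then have "U x = 0" using q0[OF x] x by simp
      then show "L *\<^sub>v x = x" using U_eq_0D[OF x] by simp
    next
      assume h: "L *\<^sub>v x = x"
      have "D j *\<^sub>v x = 0\<^sub>v n" for j
        using D_D0[OF x, of j] D_0_zero_iff[OF x] h mult_mat_zero_vec[OF D_carrier[of j]] by simp
      then show "P0 *\<^sub>v x = 0\<^sub>v n" using k0[OF x] by simp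
    qed
    moreover have "(A - 1\<^sub>m n) *\<^sub>v x = 0\<^sub>v n \<longleftrightarrow> A *\<^sub>v x = x"
    proof -
      have "(A - 1\<^sub>m n) *\<^sub>v x = A *\<^sub>v x - x"
        using A x by (simp add: minus_mult_distrib_mat_vec)
      moreover have "A *\<^sub>v x = (A *\<^sub>v x - x) + x" using A x by (intro eq_vecI) auto
      ultimately show ?thesis using x by (metis left_zero_vec minus_cancel_vec)
    qed
    ultimately show ?thesis using fixed_iff[OF x] x by (simp add: mat_kernel[OF P0(1)] mat_kernel[OF AI])
  qed
  then have "mat_kernel P0 = mat_kernel (A - 1\<^sub>m n)"
    using mat_kernel_carrier[OF P0(1)] mat_kernel_carrier[OF AI] by blast
  then have rk: "vec_space.rank n P0 = n - kernel_dim (A - 1\<^sub>m n)"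
    using rank_plus_kernel_dim[OF P0(1)] kernel_dim_cong[OF P0(1) AI] by simp
  show ?thesis using that[OF \<eta> PP e QQ PP0 rk f] .
qed
end

lemma polyhedral_fun_Max:
  assumes "finite F" "F \<noteq> {}" "F \<subseteq> carrier_vec n"
  shows "polyhedral_fun n (\<lambda>x. Max ((\<lambda>f. f \<bullet> x) ` F))"
proof -
  obtain h where h: "bij_betw h {1..card F} F"
    using ex_bij_betw_nat_finite_1[OF assms(1)] by blast
  have "(\<lambda>f. f \<bullet> x) ` F = (\<lambda>i. h i \<bullet> x) ` {1..card F}" for x
    using image_image[of "\<lambda>f. f \<bullet> x" h "{1..card F}"] bij_betw_imp_surj_on[OF h] by simp
  moreover have "1 \<le> card F" using assms(1,2) by (simp add: Suc_le_eq card_gt_0_iff)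
  ultimately show ?thesis
    using bij_betwE[OF h] assms(3) unfolding polyhedral_fun_def
    by (intro exI[of _ "card F"] exI[of _ h]) auto
qed

context limit_projection
begin

definition signed_rows :: "real mat \<Rightarrow> real vec set" where
  "signed_rows M = row M ` {..<n} \<union> (\<lambda>i. - row M i) ` {..<n}"

text \<open>
  The maximum over these functionals is the larger of \<open>|L x|\<close> and all \<open>\<rho>\<^sup>-\<^sup>j |D\<^sub>j x|\<close> with \<open>j < N\<close>, in the
  maximum norm.  The zero functional keeps the set nonempty in dimension 0.
\<close>

definition faces :: "real vec set" where
  "faces = insert (0\<^sub>v n) (signed_rows L \<union> (\<Union>j<N. signed_rows ((1 / \<rho>) ^ j \<cdot>\<^sub>m D j)))"

definition V :: "real vec \<Rightarrow> real" where
  "V x = Max ((\<lambda>f. f \<bullet> x) ` faces)"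

lemma finite_faces: "finite faces"
  by (simp add: faces_def signed_rows_def)

lemma faces_carrier: "faces \<subseteq> carrier_vec n"
proof -
  have rows: "signed_rows M \<subseteq> carrier_vec n" if "M \<in> carrier_mat n n" for M
    using that by (auto simp: signed_rows_def)
  have "(1 / \<rho>) ^ j \<cdot>\<^sub>m D j \<in> carrier_mat n n" for j using D_carrier by simp
  note rows[OF this]
  with rows[OF L] show ?thesis unfolding faces_def using zero_carrier_vec by blast
qed

lemma signed_rows_le_iff:
  assumes M: "M \<in> carrier_mat n n" and x: "x \<in> carrier_vec n"
  shows "(\<forall>f \<in> signed_rows M. f \<bullet> x \<le> b) \<longleftrightarrow> (\<forall>i<n. \<bar>(M *\<^sub>v x) $ i\<bar> \<le> b)"
proof -
  have "(\<forall>f \<in> signed_rows M. f \<bullet> x \<le> b) \<longleftrightarrow> (\<forall>i<n. row M i \<bullet> x \<le> b \<and> (- row M i) \<bullet> x \<le> b)"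
    unfolding signed_rows_def by blast
  also have "\<dots> \<longleftrightarrow> (\<forall>i<n. \<bar>(M *\<^sub>v x) $ i\<bar> \<le> b)"
  proof -
    have "(- row M i) \<bullet> x = - ((M *\<^sub>v x) $ i)" "row M i \<bullet> x = (M *\<^sub>v x) $ i" if "i < n" for i
      using that M x uminus_scalar_prod[of "row M i" n x] by auto
    then show ?thesis unfolding abs_le_iff by (metis (no_types, lifting))
  qed
  finally show ?thesis .
qed

lemma V_le_iff:
  assumes x: "x \<in> carrier_vec n"
  shows "V x \<le> b \<longleftrightarrow> 0 \<le> b \<and> (\<forall>i<n. \<bar>(L *\<^sub>v x) $ i\<bar> \<le> b)
    \<and> (\<forall>j<N. \<forall>i<n. (1 / \<rho>) ^ j * \<bar>(D j *\<^sub>v x) $ i\<bar> \<le> b)"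
proof -
  have "V x \<le> b \<longleftrightarrow> (\<forall>f \<in> faces. f \<bullet> x \<le> b)"
    unfolding V_def using finite_faces by (subst Max_le_iff) (auto simp: faces_def)
  also have "\<dots> \<longleftrightarrow> 0 \<le> b \<and> (\<forall>f \<in> signed_rows L. f \<bullet> x \<le> b)
      \<and> (\<forall>j<N. \<forall>f \<in> signed_rows ((1 / \<rho>) ^ j \<cdot>\<^sub>m D j). f \<bullet> x \<le> b)"
    using x by (auto simp: faces_def)
  also have "(\<forall>j<N. \<forall>f \<in> signed_rows ((1 / \<rho>) ^ j \<cdot>\<^sub>m D j). f \<bullet> x \<le> b)
      \<longleftrightarrow> (\<forall>j<N. \<forall>i<n. (1 / \<rho>) ^ j * \<bar>(D j *\<^sub>v x) $ i\<bar> \<le> b)"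
  proof -
    have "(\<forall>f \<in> signed_rows ((1 / \<rho>) ^ j \<cdot>\<^sub>m D j). f \<bullet> x \<le> b)
      \<longleftrightarrow> (\<forall>i<n. (1 / \<rho>) ^ j * \<bar>(D j *\<^sub>v x) $ i\<bar> \<le> b)" for j
    proof -
      have "((1 / \<rho>) ^ j \<cdot>\<^sub>m D j) *\<^sub>v x = (1 / \<rho>) ^ j \<cdot>\<^sub>v (D j *\<^sub>v x)"
        by (rule smult_mat_mult_vec[OF D_carrier x])
      then show ?thesis
        using signed_rows_le_iff[of "(1 / \<rho>) ^ j \<cdot>\<^sub>m D j" x b] D_carrier[of j] x
          vec_carriers(3)[OF x, of j] \<rho> by (simp add: abs_mult del: index_mult_mat_vec)
    qed
    then show ?thesis by simp
  qed
  finally show ?thesis unfolding signed_rows_le_iff[OF L x] .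
qed

text \<open>
  For \<open>F = A / \<eta> - ((1 - \<eta>) / \<eta>) I\<close> one has
  \<open>D\<^sub>j F x = D\<^sub>j\<^sub>+\<^sub>1 x / \<eta> - ((1 - \<eta>) / \<eta>) D\<^sub>j x\<close>, where the shift contributes a factor \<open>\<rho>\<close> to the weighted
  size of the first term.  The total factor is at most \<open>(\<rho> + 1 - \<eta>) / \<eta>\<close>.  The component \<open>L x\<close> does
  not change at all.
\<close>

lemma polyhedral_certificate:
  shows "\<exists>\<eta> V. 0 < \<eta> \<and> \<eta> < 1 \<and> weak_polyhedral_lyapunov n (A_dt n A \<eta>) V"
proof -
  \<comment> \<open>the value for which \<open>(\<rho> + 1 - \<eta>) / \<eta>\<close>, the growth factor of a weighted deviation, equals 1\<close>
  define \<eta> where "\<eta> = (1 + \<rho>) / 2"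
  have \<eta>: "0 < \<eta>" "\<eta> < 1" using \<rho> by (auto simp: \<eta>_def)
  let ?F = "A_dt n A \<eta>"
  note F = A_dt_vec[OF A, of _ \<eta>]
  have MF: "(M *\<^sub>v (?F *\<^sub>v x)) $ i = (1 / \<eta>) * (M *\<^sub>v (A *\<^sub>v x)) $ i - ((1 - \<eta>) / \<eta>) * (M *\<^sub>v x) $ i"
    if M: "M \<in> carrier_mat n n" and x: "x \<in> carrier_vec n" and i: "i < n" for M x i
  proof -
    have c: "(1 / \<eta>) \<cdot>\<^sub>v (A *\<^sub>v x) \<in> carrier_vec n" "((1 - \<eta>) / \<eta>) \<cdot>\<^sub>v x \<in> carrier_vec n"
      using vec_carriers(1)[OF x] x by auto
    have "M *\<^sub>v (?F *\<^sub>v x) = (1 / \<eta>) \<cdot>\<^sub>v (M *\<^sub>v (A *\<^sub>v x)) - ((1 - \<eta>) / \<eta>) \<cdot>\<^sub>v (M *\<^sub>v x)"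
      unfolding F[OF x] mult_minus_distrib_mat_vec[OF M c] mult_mat_vec[OF M vec_carriers(1)[OF x]]
        mult_mat_vec[OF M x] ..
    then show ?thesis using i carrier_matD[OF M] by (simp del: index_mult_mat_vec)
  qed
  have Fc: "?F *\<^sub>v x \<in> carrier_vec n" if x: "x \<in> carrier_vec n" for x
    unfolding F[OF x] using vec_carriers(1)[OF x] x by auto
  have nn: "V x \<ge> 0" if "x \<in> carrier_vec n" for x using V_le_iff[OF that, of "V x"] by simp
  have lyap: "V (?F *\<^sub>v x) \<le> V x" if x: "x \<in> carrier_vec n" for x
    unfolding V_le_iff[OF Fc[OF x]]
  proof (intro conjI allI impI)
    note le = iffD1[OF V_le_iff[OF x] order_refl]
    show "0 \<le> V x" by (rule nn[OF x])
    fix i assume i: "i < n"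
    have "(L *\<^sub>v (?F *\<^sub>v x)) $ i = (L *\<^sub>v x) $ i"
      unfolding MF[OF L x i] L_A[OF x] using \<eta> by (simp add: field_simps)
    then show "\<bar>(L *\<^sub>v (?F *\<^sub>v x)) $ i\<bar> \<le> V x" using le i by simp
    fix j assume j: "j < N"
    have b: "\<bar>(D k *\<^sub>v x) $ i\<bar> \<le> \<rho> ^ k * V x" if "k < N" "i < n" for k i
    proof -
      have "(1 / \<rho>) ^ k * \<bar>(D k *\<^sub>v x) $ i\<bar> \<le> V x" using le that by blast
      then show ?thesis using \<rho> by (simp add: power_divide field_simps del: index_mult_mat_vec)
    qed
    have bS: "\<bar>(D (Suc j) *\<^sub>v x) $ i\<bar> \<le> \<rho> ^ Suc j * V x"
    proof (cases "Suc j < N")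
      case False
      then have "Suc j = N" using j by simp
      then show ?thesis using D_max_contr[OF x _ i, of "V x"] b[OF N] by simp
    qed (use b i in blast)
    have "\<bar>(D j *\<^sub>v (?F *\<^sub>v x)) $ i\<bar>
        \<le> (1 / \<eta>) * \<bar>(D (Suc j) *\<^sub>v x) $ i\<bar> + ((1 - \<eta>) / \<eta>) * \<bar>(D j *\<^sub>v x) $ i\<bar>"
      unfolding MF[OF D_carrier x i] D_A[OF x] using \<eta>
      by (intro order_trans[OF abs_triangle_ineq4]) (auto simp: abs_mult)
    also have "\<dots> \<le> (1 / \<eta>) * (\<rho> ^ Suc j * V x) + ((1 - \<eta>) / \<eta>) * (\<rho> ^ j * V x)"
      using bS b[OF j i] \<eta> by (intro add_mono mult_left_mono) auto
    also have "\<dots> = ((\<rho> + 1 - \<eta>) / \<eta>) * (\<rho> ^ j * V x)"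
      using \<eta> by (simp add: field_simps)
    also have "(\<rho> + 1 - \<eta>) / \<eta> = 1" using \<rho> by (simp add: \<eta>_def field_simps)
    finally have "\<bar>(D j *\<^sub>v (?F *\<^sub>v x)) $ i\<bar> \<le> \<rho> ^ j * V x" by simp
    then show "(1 / \<rho>) ^ j * \<bar>(D j *\<^sub>v (?F *\<^sub>v x)) $ i\<bar> \<le> V x"
      using \<rho> by (simp add: power_divide field_simps del: index_mult_mat_vec)
  qed
  have "V (0\<^sub>v n) \<le> 0"
  proof -
    show ?thesis using V_le_iff[of "0\<^sub>v n" 0] mult_mat_zero_vec[OF L] mult_mat_zero_vec[OF D_carrier]
      by (simp del: index_mult_mat_vec)
  qed
  then have "V (0\<^sub>v n) = 0" using nn[of "0\<^sub>v n"] by simp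
  moreover have "V x > 0" if x: "x \<in> carrier_vec n" "x \<noteq> 0\<^sub>v n" for x
  proof (rule ccontr)
    assume "\<not> V x > 0"
    then have "V x \<le> 0" by simp
    note le = iffD1[OF V_le_iff[OF x(1)] this]
    have "\<bar>(L *\<^sub>v x) $ i\<bar> \<le> 0" "(1 / \<rho>) ^ 0 * \<bar>(D 0 *\<^sub>v x) $ i\<bar> \<le> 0" if "i < n" for i
      using le N that by blast+
    then have "L *\<^sub>v x = 0\<^sub>v n" "D 0 *\<^sub>v x = 0\<^sub>v n"
      using L D_carrier[of 0] by (auto intro!: eq_vecI simp del: index_mult_mat_vec)
    then show False using D_0_zero_iff[OF x(1)] x(2) by simp
  qed
  ultimately have "weak_lyapunov n ?F V"
    using lyap by (auto simp: weak_lyapunov_def pos_def_fun_def)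
  moreover have "polyhedral_fun n V"
    unfolding V_def using finite_faces faces_carrier
    by (intro polyhedral_fun_Max) (auto simp: faces_def)
  ultimately show ?thesis using \<eta> by (auto simp: weak_polyhedral_lyapunov_def)
qed
end

text \<open>
  Any \<open>\<rho>\<close> above the decay rate \<open>\<rho>\<^sub>0\<close> works, because the factor \<open>(\<rho>\<^sub>0 / \<rho>)\<^sup>N\<close> eventually absorbs the
  constant.  The factor \<open>n\<^sup>2\<close> comes from summing over rows and columns.
\<close>

lemma limit_projectionI:
  assumes A: "A \<in> carrier_mat n n" and L: "L \<in> carrier_mat n n"
    and AL: "A * L = L" "L * A = L" "L * L = L" and \<rho>0: "0 < \<rho>0" "\<rho>0 < 1" and c: "c \<ge> 0"
    and nb: "\<And>k. norm_bound (A ^\<^sub>m k - L) (c * \<rho>0 ^ k)"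
  obtains \<rho> N where "limit_projection n A L \<rho> N"
proof -
  define \<rho> where "\<rho> = (1 + \<rho>0) / 2"
  have \<rho>: "0 < \<rho>" "\<rho> < 1" "\<rho>0 < \<rho>" using \<rho>0 by (auto simp: \<rho>_def)
  let ?K = "(real n)\<^sup>2 * c"
  have "(\<lambda>k. ?K * (\<rho>0 / \<rho>) ^ k) \<longlonglongrightarrow> ?K * 0"
    using \<rho> \<rho>0 by (intro tendsto_mult tendsto_const LIMSEQ_power_zero) auto
  then have "\<forall>\<^sub>F k in sequentially. ?K * (\<rho>0 / \<rho>) ^ k < 1"
    by (intro order_tendstoD(2)[of _ 0]) auto
  then obtain N where N: "N > 0" "?K * (\<rho>0 / \<rho>) ^ N < 1"
    unfolding eventually_sequentially by (metis less_add_one zero_less_Suc Suc_eq_plus1 le_add1 lessI less_imp_le)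
  have small: "?K * \<rho>0 ^ N \<le> \<rho> ^ N"
    using N(2) \<rho> by (simp add: power_divide field_simps)
  let ?b = "c * \<rho>0 ^ N"
  have b0: "?b \<ge> 0" using c \<rho>0 by simp
  let ?D = "A ^\<^sub>m N - L"
  have D: "?D \<in> carrier_mat n n" using L by (rule minus_carrier_mat)
  have entry: "\<bar>(?D *\<^sub>v y) $ i\<bar> \<le> real n * ?b * m"
    if y: "y \<in> carrier_vec n" and m: "\<And>i. i < n \<Longrightarrow> \<bar>y $ i\<bar> \<le> m" and i: "i < n" for y m i
  proof -
    have "(?D *\<^sub>v y) $ i = (\<Sum>j\<in>{0..<n}. ?D $$ (i,j) * y $ j)"
      using D y i by (auto simp: scalar_prod_def simp del: index_minus_mat)
    also have "\<bar>\<dots>\<bar> \<le> (\<Sum>j\<in>{0..<n}. \<bar>?D $$ (i,j) * y $ j\<bar>)" by (rule sum_abs)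
    also have "\<dots> \<le> (\<Sum>j\<in>{0..<n}. ?b * m)"
      unfolding abs_mult using norm_bound_index[OF nb D i] m b0
      by (intro sum_mono mult_mono) auto
    finally show ?thesis by simp
  qed
  have "limit_projection n A L \<rho> N"
  proof (unfold_locales, fact A, fact L, fact AL(1), fact AL(2), fact AL(3), fact \<rho>(1), fact \<rho>(2), fact N(1))
    fix y :: "real vec" and b i
    assume y: "y \<in> carrier_vec n" "\<And>i. i < n \<Longrightarrow> \<bar>y $ i\<bar> \<le> b" and i: "i < n"
    have b: "b \<ge> 0" using y(2)[OF i] by simp
    have "real n * ?b * b \<le> ?K * \<rho>0 ^ N * b"
    proof (intro mult_right_mono b)
      have "real n * 1 \<le> (real n)\<^sup>2" using i unfolding power2_eq_square by (intro mult_left_mono) auto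
      then show "real n * ?b \<le> ?K * \<rho>0 ^ N"
        using b0 mult_right_mono[of "real n" "(real n)\<^sup>2" ?b] by (simp add: mult_ac)
    qed
    also have "\<dots> \<le> \<rho> ^ N * b" by (intro mult_right_mono small b)
    finally show "\<bar>(?D *\<^sub>v y) $ i\<bar> \<le> \<rho> ^ N * b" using entry[OF y i] by simp
  next
    fix y :: "real vec" assume y: "y \<in> carrier_vec n"
    have "vec_norm (?D *\<^sub>v y) \<le> (\<Sum>i\<in>{0..<n}. \<bar>(?D *\<^sub>v y) $ i\<bar>)"
      using vec_norm_le_sum[of "?D *\<^sub>v y"] unfolding dim_mult_mat_vec carrier_matD(1)[OF D] .
    also have "\<dots> \<le> (\<Sum>i\<in>{0..<n}. real n * ?b * vec_norm y)"
      using y abs_index_le_vec_norm[of _ y] by (intro sum_mono entry[OF y]) auto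
    also have "\<dots> = ?K * \<rho>0 ^ N * vec_norm y" by (simp add: power2_eq_square mult_ac)
    also have "\<dots> \<le> \<rho> ^ N * vec_norm y" by (intro mult_right_mono small vec_norm_nonneg)
    finally show "vec_norm (?D *\<^sub>v y) \<le> \<rho> ^ N * vec_norm y" .
  qed
  then show ?thesis by (rule that)
qed

section \<open>From Lyapunov functions to stability\<close>

text \<open>
  Bolzano-Weierstrass in every coordinate in turn.
\<close>

lemma bounded_vec_seq_convergent_subseq:
  fixes X :: "nat \<Rightarrow> real vec"
  assumes B: "\<And>k i. i < n \<Longrightarrow> \<bar>X k $ i\<bar> \<le> B"
  shows "\<exists>r x. strict_mono r \<and> x \<in> carrier_vec n \<and> (\<forall>i<n. (\<lambda>k. X (r k) $ i) \<longlonglongrightarrow> x $ i)"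
proof -
  have "m \<le> n \<Longrightarrow> \<exists>r :: nat \<Rightarrow> nat. strict_mono r \<and> (\<forall>i<m. convergent (\<lambda>k. X (r k) $ i))" for m
  proof (induction m)
    case 0
    show ?case by (intro exI[of _ id]) (simp add: strict_mono_def)
  next
    case (Suc m)
    then obtain r where r: "strict_mono r" "\<forall>i<m. convergent (\<lambda>k. X (r k) $ i)" by auto
    obtain f where f: "strict_mono f" "monoseq (\<lambda>k. X (r (f k)) $ m)"
      using seq_monosub[of "\<lambda>k. X (r k) $ m"] by auto
    have "Bseq (\<lambda>k. X (r (f k)) $ m)"
      using B[of m] Suc.prems by (intro BseqI'[of _ B]) auto
    then have "convergent (\<lambda>k. X (r (f k)) $ m)" using f by (intro Bseq_monoseq_convergent)
    moreover have "convergent (\<lambda>k. X (r (f k)) $ i)" if "i < m" for i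
      using convergent_subseq_convergent[OF _ f(1), of "\<lambda>k. X (r k) $ i"] r(2) that by (simp add: o_def)
    ultimately have "\<forall>i<Suc m. convergent (\<lambda>k. X (r (f k)) $ i)" by (auto simp: less_Suc_eq)
    moreover have "strict_mono (r \<circ> f)" using r f by (simp add: strict_mono_o)
    ultimately show ?case by (intro exI[of _ "r \<circ> f"]) (simp add: o_def)
  qed
  from this[of n] obtain r where r: "strict_mono r" "\<forall>i<n. convergent (\<lambda>k. X (r k) $ i)" by auto
  have "(\<lambda>k. X (r k) $ i) \<longlonglongrightarrow> vec n (\<lambda>i. lim (\<lambda>k. X (r k) $ i)) $ i" if "i < n" for i
    using r(2) that by (simp add: convergent_LIMSEQ_iff)
  then show ?thesis
    using r(1) by (intro exI[of _ r] exI[of _ "vec n (\<lambda>i. lim (\<lambda>k. X (r k) $ i))"]) auto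
qed

text \<open>
  Vectors of all dimensions share one type, so continuity on the \<open>n\<close>-dimensional space is phrased with
  coordinatewise convergent sequences.
\<close>

definition seq_continuous :: "nat \<Rightarrow> (real vec \<Rightarrow> real) \<Rightarrow> bool" where
  "seq_continuous n V \<longleftrightarrow> (\<forall>X x. (\<forall>k. X k \<in> carrier_vec n) \<longrightarrow> x \<in> carrier_vec n \<longrightarrow>
     (\<forall>i<n. (\<lambda>k. X k $ i) \<longlonglongrightarrow> x $ i) \<longrightarrow> (\<lambda>k. V (X k)) \<longlonglongrightarrow> V x)"

lemma seq_continuousD:
  assumes "seq_continuous n V" "\<And>k. X k \<in> carrier_vec n" "x \<in> carrier_vec n"
    and "\<And>i. i < n \<Longrightarrow> (\<lambda>k. X k $ i) \<longlonglongrightarrow> x $ i"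
  shows "(\<lambda>k. V (X k)) \<longlonglongrightarrow> V x"
  using assms unfolding seq_continuous_def by simp

text \<open>
  On the unit sphere \<open>V\<close> is bounded away from 0 by compactness, and homogeneity spreads the bound.  The
  exponent \<open>p\<close> is 1 for polyhedral functions and 2 for quadratic forms.
\<close>

lemma homogeneous_pos_def_lower_bound:
  assumes cont: "seq_continuous n V" and pd: "pos_def_fun n V" and p: "p > 0"
    and hom: "\<And>c x. c > 0 \<Longrightarrow> x \<in> carrier_vec n \<Longrightarrow> V (c \<cdot>\<^sub>v x) = c ^ p * V x"
  obtains a where "a > 0" "\<And>x. x \<in> carrier_vec n \<Longrightarrow> a * vec_norm x ^ p \<le> V x"
proof -
  have "\<exists>a>0. \<forall>x \<in> carrier_vec n. vec_norm x = 1 \<longrightarrow> a \<le> V x"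
  proof (rule ccontr)
    assume "\<not> ?thesis"
    then have "\<forall>k. \<exists>x. x \<in> carrier_vec n \<and> vec_norm x = 1 \<and> V x < 1 / real (Suc k)"
      by (metis not_le of_nat_0_less_iff zero_less_Suc zero_less_divide_1_iff)
    then obtain X where X: "\<And>k. X k \<in> carrier_vec n" "\<And>k. vec_norm (X k) = 1"
      "\<And>k. V (X k) < 1 / real (Suc k)" by metis
    have bd: "\<bar>X k $ i\<bar> \<le> 1" if "i < n" for k i
      using abs_index_le_vec_norm[of i "X k"] X(1,2)[of k] that by simp
    obtain r x where r: "strict_mono r" and x: "x \<in> carrier_vec n"
      and lim: "\<And>i. i < n \<Longrightarrow> (\<lambda>k. X (r k) $ i) \<longlonglongrightarrow> x $ i"
      using bounded_vec_seq_convergent_subseq[of n X 1, OF bd] by auto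
    have "(\<lambda>k. V (X (r k))) \<longlonglongrightarrow> V x"
      by (rule seq_continuousD[OF cont X(1) x lim])
    moreover have "(\<lambda>k. 1 / real (Suc (r k))) \<longlonglongrightarrow> 0"
      using LIMSEQ_subseq_LIMSEQ[OF LIMSEQ_Suc[OF lim_1_over_n] r] by (simp add: o_def)
    ultimately have "V x \<le> 0"
      by (rule LIMSEQ_le) (use X(3) less_imp_le in blast)
    then have x0: "x = 0\<^sub>v n" using pd x unfolding pos_def_fun_def by force
    have "vec_norm (X (r k)) \<le> (\<Sum>i\<in>{0..<n}. \<bar>X (r k) $ i\<bar>)" for k
      using vec_norm_le_sum[of "X (r k)"] X(1)[of "r k"] by simp
    then have "\<forall>k. 1 \<le> (\<Sum>i\<in>{0..<n}. \<bar>X (r k) $ i\<bar>)" using X(2) by metis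
    moreover have "(\<lambda>k. \<Sum>i\<in>{0..<n}. \<bar>X (r k) $ i\<bar>) \<longlonglongrightarrow> (\<Sum>i\<in>{0..<n}. \<bar>x $ i\<bar>)"
      using lim by (intro tendsto_sum tendsto_rabs) auto
    ultimately have "1 \<le> (\<Sum>i\<in>{0..<n}. \<bar>x $ i\<bar>)" by (intro LIMSEQ_le_const) auto
    then show False using x0 by simp
  qed
  then obtain a where a: "a > 0" "\<And>x. x \<in> carrier_vec n \<Longrightarrow> vec_norm x = 1 \<Longrightarrow> a \<le> V x" by blast
  have "a * vec_norm x ^ p \<le> V x" if x: "x \<in> carrier_vec n" for x
  proof (cases "x = 0\<^sub>v n")
    case True
    then have "vec_norm x = 0" "V x = 0" using pd vec_norm_0_iff[OF x] by (auto simp: pos_def_fun_def)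
    then show ?thesis using zero_power[OF p] by (metis mult_zero_right order_refl)
  next
    case False
    then have pos: "vec_norm x > 0" using vec_norm_0_iff[OF x] vec_norm_nonneg[of x] by simp
    let ?y = "(1 / vec_norm x) \<cdot>\<^sub>v x"
    have "a \<le> V ?y" using x pos by (intro a) (auto simp: vec_norm_smult)
    also have "V ?y = (1 / vec_norm x) ^ p * V x" using hom pos x by simp
    finally show ?thesis using pos by (simp add: power_divide field_simps)
  qed
  then show ?thesis using that a(1) by blast
qed

text \<open>
  Continuity of \<open>V\<close> at the origin makes \<open>V\<close> small for small initial values, monotonicity keeps it small
  along the trajectory, and the lower bound turns this into a bound on the norm.
\<close>

lemma weak_lyapunov_imp_stable:
  assumes F: "F \<in> carrier_mat n n" and W: "weak_lyapunov n F V"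
    and cont: "seq_continuous n V" and p: "p > 0"
    and hom: "\<And>c x. c > 0 \<Longrightarrow> x \<in> carrier_vec n \<Longrightarrow> V (c \<cdot>\<^sub>v x) = c ^ p * V x"
  shows "marginally_stable_system n F"
proof -
  have pd: "pos_def_fun n V" and dec: "\<And>x. x \<in> carrier_vec n \<Longrightarrow> V (F *\<^sub>v x) \<le> V x"
    using W by (auto simp: weak_lyapunov_def)
  obtain a where a: "a > 0" "\<And>x. x \<in> carrier_vec n \<Longrightarrow> a * vec_norm x ^ p \<le> V x"
    using homogeneous_pos_def_lower_bound[OF cont pd p hom] by blast
  have traj: "V (trajectory F x k) \<le> V x" if x: "x \<in> carrier_vec n" for x k
  proof (induction k)
    case (Suc k)
    then show ?case using dec[OF trajectory_carrier[OF F x, of k]] by simp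
  qed simp
  show ?thesis unfolding marginally_stable_system_def
  proof (intro allI impI)
    fix \<epsilon> :: real assume \<epsilon>: "\<epsilon> > 0"
    have "\<exists>\<delta>>0. \<forall>x \<in> carrier_vec n. vec_norm x < \<delta> \<longrightarrow> V x < a * \<epsilon> ^ p"
    proof (rule ccontr)
      assume "\<not> ?thesis"
      then have "\<forall>k. \<exists>x. x \<in> carrier_vec n \<and> vec_norm x < 1 / real (Suc k) \<and> a * \<epsilon> ^ p \<le> V x"
        by (metis not_le of_nat_0_less_iff zero_less_Suc zero_less_divide_1_iff)
      then obtain X where X: "\<And>k. X k \<in> carrier_vec n" "\<And>k. vec_norm (X k) < 1 / real (Suc k)"
        "\<And>k. a * \<epsilon> ^ p \<le> V (X k)" by metis
      have l: "(\<lambda>k. 1 / real (Suc k)) \<longlonglongrightarrow> 0" using LIMSEQ_Suc[OF lim_1_over_n] .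
      have "(\<lambda>k. vec_norm (X k - 0\<^sub>v n)) \<longlonglongrightarrow> 0"
      proof (rule tendsto_sandwich[OF _ _ tendsto_const l])
        have "vec_norm (X k - 0\<^sub>v n) = vec_norm (X k)" for k using X(1)[of k] by simp
        then show "\<forall>\<^sub>F k in sequentially. vec_norm (X k - 0\<^sub>v n) \<le> 1 / real (Suc k)"
          using X(2) less_imp_le by (intro always_eventually) auto
      qed (simp add: vec_norm_nonneg)
      then have lim: "\<forall>i<n. (\<lambda>k. X k $ i) \<longlonglongrightarrow> 0\<^sub>v n $ i"
        by (rule iffD1[OF vec_norm_diff_tendsto_iff[of X n "0\<^sub>v n", OF X(1) zero_carrier_vec]])
      have "(\<lambda>k. V (X k)) \<longlonglongrightarrow> V (0\<^sub>v n)"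
        by (rule seq_continuousD[OF cont X(1) zero_carrier_vec lim[rule_format]])
      then have "a * \<epsilon> ^ p \<le> V (0\<^sub>v n)" by (rule LIMSEQ_le_const) (use X(3) in auto)
      then show False
        using mult_pos_pos[OF a(1) zero_less_power[OF \<epsilon>, of p]] pd by (simp add: pos_def_fun_def)
    qed
    then obtain \<delta> where \<delta>: "\<delta> > 0" "\<And>x. x \<in> carrier_vec n \<Longrightarrow> vec_norm x < \<delta> \<Longrightarrow> V x < a * \<epsilon> ^ p" by blast
    have "vec_norm (trajectory F x k) < \<epsilon>" if x: "x \<in> carrier_vec n" "vec_norm x < \<delta>" for x k
    proof -
      have "a * vec_norm (trajectory F x k) ^ p < a * \<epsilon> ^ p"
        using a(2)[OF trajectory_carrier[OF F x(1), of k]] traj[OF x(1), of k] \<delta>(2)[OF x] by linarith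
      then have "vec_norm (trajectory F x k) ^ p < \<epsilon> ^ p" using a(1) by simp
      then show ?thesis using \<epsilon> by (simp add: power_less_imp_less_base)
    qed
    then show "\<exists>\<delta>>0. \<forall>x0\<in>carrier_vec n. vec_norm x0 < \<delta> \<longrightarrow> (\<forall>k. vec_norm (trajectory F x0 k) < \<epsilon>)"
      using \<delta>(1) by blast
  qed
qed

lemma tendsto_Max_image:
  fixes g :: "'i \<Rightarrow> 'b \<Rightarrow> real"
  assumes "finite S" "S \<noteq> {}" "\<And>i. i \<in> S \<Longrightarrow> (g i \<longlongrightarrow> l i) F"
  shows "((\<lambda>k. Max ((\<lambda>i. g i k) ` S)) \<longlongrightarrow> Max (l ` S)) F"
  using assms
proof (induction S rule: finite_ne_induct)
  case (insert i S)
  then show ?case by (simp add: tendsto_max)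
qed simp

lemma tendsto_scalar_prod:
  fixes X Y :: "nat \<Rightarrow> real vec"
  assumes "\<And>k. Y k \<in> carrier_vec n" "y \<in> carrier_vec n"
    and "\<And>i. i < n \<Longrightarrow> (\<lambda>k. X k $ i) \<longlonglongrightarrow> x $ i" "\<And>i. i < n \<Longrightarrow> (\<lambda>k. Y k $ i) \<longlonglongrightarrow> y $ i"
  shows "(\<lambda>k. X k \<bullet> Y k) \<longlonglongrightarrow> x \<bullet> y"
proof -
  have "dim_vec (Y k) = n" "dim_vec y = n" for k using assms(1,2) by auto
  then show ?thesis using assms(3,4) by (auto simp: scalar_prod_def intro!: tendsto_intros)
qed

lemma polyhedral_imp_stable:
  assumes F: "F \<in> carrier_mat n n" and W: "weak_polyhedral_lyapunov n F V"
  shows "marginally_stable_system n F"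
proof -
  obtain s :: nat and f where s: "s \<ge> 1" and f: "\<And>i. i \<in> {1..s} \<Longrightarrow> f i \<in> carrier_vec n"
    and V: "\<And>x. x \<in> carrier_vec n \<Longrightarrow> V x = (MAX i\<in>{1..s}. f i \<bullet> x)"
    using W unfolding weak_polyhedral_lyapunov_def polyhedral_fun_def by blast
  have ne: "finite {1..s}" "{1..s} \<noteq> {}" using s by auto
  have "seq_continuous n V" unfolding seq_continuous_def
  proof (intro allI impI)
    fix X and x :: "real vec"
    assume X: "\<forall>k. X k \<in> carrier_vec n" and x: "x \<in> carrier_vec n"
      and lim: "\<forall>i<n. (\<lambda>k. X k $ i) \<longlonglongrightarrow> x $ i"
    have "(\<lambda>k. MAX i\<in>{1..s}. f i \<bullet> X k) \<longlonglongrightarrow> (MAX i\<in>{1..s}. f i \<bullet> x)"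
      using ne X x lim by (intro tendsto_Max_image tendsto_scalar_prod) auto
    then show "(\<lambda>k. V (X k)) \<longlonglongrightarrow> V x" using V X x by simp
  qed
  moreover have "V (c \<cdot>\<^sub>v x) = c ^ 1 * V x" if c: "c > 0" and x: "x \<in> carrier_vec n" for c x
  proof -
    have "V (c \<cdot>\<^sub>v x) = Max ((\<lambda>y. c * y) ` (\<lambda>i. f i \<bullet> x) ` {1..s})"
      using x f by (simp add: V image_image cong: image_cong_simp)
    also have "\<dots> = c * Max ((\<lambda>i. f i \<bullet> x) ` {1..s})"
      using ne c by (intro mono_Max_commute[symmetric]) (auto simp: mono_def)
    finally show ?thesis using V[OF x] by simp
  qed
  ultimately show ?thesis
    using W by (intro weak_lyapunov_imp_stable[where V = V and p = 1, OF F]) (auto simp: weak_polyhedral_lyapunov_def)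
qed

lemma quad_form_seq_continuous:
  assumes P: "P \<in> carrier_mat n n"
  shows "seq_continuous n (quad_form P)"
  unfolding seq_continuous_def
proof (intro allI impI)
  fix X and x :: "real vec"
  assume X: "\<forall>k. X k \<in> carrier_vec n" and x: "x \<in> carrier_vec n"
    and lim: "\<forall>i<n. (\<lambda>k. X k $ i) \<longlonglongrightarrow> x $ i"
  have Pc: "P *\<^sub>v y \<in> carrier_vec n" if "y \<in> carrier_vec n" for y
    using P that by (rule mult_mat_vec_carrier)
  have "(\<lambda>k. (P *\<^sub>v X k) $ i) \<longlonglongrightarrow> (P *\<^sub>v x) $ i" if i: "i < n" for i
  proof -
    have "(\<lambda>k. row P i \<bullet> X k) \<longlonglongrightarrow> row P i \<bullet> x"
      by (rule tendsto_scalar_prod[of X n x "\<lambda>_. row P i"]) (use X x lim in auto)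
    then show ?thesis using P i by simp
  qed
  then show "(\<lambda>k. quad_form P (X k)) \<longlonglongrightarrow> quad_form P x"
    by (intro tendsto_scalar_prod[where X = X and Y = "\<lambda>k. P *\<^sub>v X k"]) (use lim X x Pc in auto)
qed

lemma quad_form_homogeneous:
  assumes P: "P \<in> carrier_mat n n" and x: "x \<in> carrier_vec n"
  shows "quad_form P (c \<cdot>\<^sub>v x) = c ^ 2 * quad_form P x"
proof -
  have "P *\<^sub>v x \<in> carrier_vec n" using P x by (rule mult_mat_vec_carrier)
  then show ?thesis using x by (simp add: mult_mat_vec[OF P x] power2_eq_square)
qed

lemma pos_def_mat_imp_fun:
  assumes "pos_def_mat n P"
  shows "pos_def_fun n (quad_form P)"
proof -
  have "P *\<^sub>v 0\<^sub>v n \<in> carrier_vec n"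
    using assms by (intro mult_mat_vec_carrier) (auto simp: pos_def_mat_def)
  then show ?thesis using assms by (auto simp: pos_def_mat_def pos_def_fun_def)
qed

text \<open>
  With \<open>V x = x \<bullet> P x\<close> and \<open>F = A / \<eta> - ((1 - \<eta>) / \<eta>) I\<close>, expanding the squares gives
  \<open>\<eta>\<^sup>2 (V (F x) - V x) = \<eta> (V (A x) - V x) + (1 - \<eta>) V (A x - x)\<close>.
  So the matrix inequality says precisely that \<open>V\<close> is a weak Lyapunov function for \<open>F\<close>.
\<close>

lemma quadratic_imp_stable:
  assumes A: "A \<in> carrier_mat n n" and \<eta>: "0 < \<eta>" "\<eta> < 1" and P: "pos_def_mat n P"
    and neg: "neg_semidef_mat n (\<eta> \<cdot>\<^sub>m (A\<^sup>T * P * A - P)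
            + (1 - \<eta>) \<cdot>\<^sub>m ((A\<^sup>T - 1\<^sub>m n) * P * (A - 1\<^sub>m n)))"
  shows "marginally_stable_system n (A_dt n A \<eta>)"
proof -
  have Pc: "P \<in> carrier_mat n n" "P\<^sup>T = P" using P by (auto simp: pos_def_mat_def)
  have "quad_form P (A_dt n A \<eta> *\<^sub>v x) \<le> quad_form P x" if x: "x \<in> carrier_vec n" for x
  proof -
    define y where "y = A *\<^sub>v x"
    have y: "y \<in> carrier_vec n" unfolding y_def using A x by (rule mult_mat_vec_carrier)
    have PP: "P *\<^sub>v x \<in> carrier_vec n" "P *\<^sub>v y \<in> carrier_vec n"
      using mult_mat_vec_carrier[OF Pc(1)] x y by auto
    have sym: "y \<bullet> (P *\<^sub>v x) = x \<bullet> (P *\<^sub>v y)"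
      using transpose_vec_mult_scalar[OF Pc(1) x y] comm_scalar_prod[OF y PP(1)]
        comm_scalar_prod[OF PP(2) x] Pc(2) by metis
    have qf: "quad_form P (a \<cdot>\<^sub>v y - b \<cdot>\<^sub>v x)
        = a\<^sup>2 * quad_form P y - 2 * a * b * (x \<bullet> (P *\<^sub>v y)) + b\<^sup>2 * quad_form P x" for a b
    proof -
      have c: "a \<cdot>\<^sub>v y \<in> carrier_vec n" "b \<cdot>\<^sub>v x \<in> carrier_vec n"
        "a \<cdot>\<^sub>v (P *\<^sub>v y) \<in> carrier_vec n" "b \<cdot>\<^sub>v (P *\<^sub>v x) \<in> carrier_vec n" using x y PP by auto
      have e: "P *\<^sub>v (a \<cdot>\<^sub>v y - b \<cdot>\<^sub>v x) = a \<cdot>\<^sub>v (P *\<^sub>v y) - b \<cdot>\<^sub>v (P *\<^sub>v x)"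
        unfolding mult_minus_distrib_mat_vec[OF Pc(1) c(1,2)] mult_mat_vec[OF Pc(1) y] mult_mat_vec[OF Pc(1) x] ..
      have d: "a \<cdot>\<^sub>v (P *\<^sub>v y) - b \<cdot>\<^sub>v (P *\<^sub>v x) \<in> carrier_vec n" using c by auto
      show ?thesis unfolding e minus_scalar_prod_distrib[OF c(1,2) d]
          scalar_prod_minus_distrib[OF c(1) c(3,4)] scalar_prod_minus_distrib[OF c(2) c(3,4)]
        using x y PP sym by (simp add: power2_eq_square algebra_simps)
    qed
    have "\<eta> * (quad_form P y - quad_form P x) + (1 - \<eta>) * quad_form P (y - x) \<le> 0"
      using neg x unfolding neg_semidef_lyapunov_iff[OF A Pc Pc] y_def by blast
    moreover have "quad_form P (y - x) = quad_form P y - 2 * (x \<bullet> (P *\<^sub>v y)) + quad_form P x"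
      using qf[of 1 1] by simp
    moreover have "quad_form P (A_dt n A \<eta> *\<^sub>v x) = (1 / \<eta>)\<^sup>2 * quad_form P y
        - 2 * (1 / \<eta>) * ((1 - \<eta>) / \<eta>) * (x \<bullet> (P *\<^sub>v y)) + ((1 - \<eta>) / \<eta>)\<^sup>2 * quad_form P x"
      unfolding A_dt_vec[OF A x] y_def[symmetric] by (rule qf)
    then have "\<eta>\<^sup>2 * quad_form P (A_dt n A \<eta> *\<^sub>v x) = (\<eta> * (1 / \<eta>))\<^sup>2 * quad_form P y
        - 2 * (\<eta> * (1 / \<eta>)) * (\<eta> * ((1 - \<eta>) / \<eta>)) * (x \<bullet> (P *\<^sub>v y))
        + (\<eta> * ((1 - \<eta>) / \<eta>))\<^sup>2 * quad_form P x"
      by (simp only: power_mult_distrib power2_eq_square distrib_left right_diff_distrib mult_ac)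
    then have "\<eta>\<^sup>2 * quad_form P (A_dt n A \<eta> *\<^sub>v x) = quad_form P y
        - 2 * (1 - \<eta>) * (x \<bullet> (P *\<^sub>v y)) + (1 - \<eta>)\<^sup>2 * quad_form P x"
      using \<eta>(1) by simp
    then have "\<eta>\<^sup>2 * (quad_form P (A_dt n A \<eta> *\<^sub>v x) - quad_form P x)
        = \<eta> * (quad_form P y - quad_form P x)
          + (1 - \<eta>) * (quad_form P y - 2 * (x \<bullet> (P *\<^sub>v y)) + quad_form P x)"
      by (simp add: power2_eq_square algebra_simps)
    ultimately have "\<eta>\<^sup>2 * (quad_form P (A_dt n A \<eta> *\<^sub>v x) - quad_form P x) \<le> 0" by simp
    then show ?thesis using \<eta> by (simp add: mult_le_0_iff)
  qed
  then have "weak_lyapunov n (A_dt n A \<eta>) (quad_form P)"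
    using pos_def_mat_imp_fun[OF P] by (simp add: weak_lyapunov_def)
  then show ?thesis
    by (rule weak_lyapunov_imp_stable[where p = 2, OF A_dt_carrier _ quad_form_seq_continuous[OF Pc(1)]])
      (simp, rule quad_form_homogeneous[OF Pc(1)])
qed

section \<open>Back to the block form\<close>

lemma mult_unit_vec_index:
  fixes M :: "'a :: comm_ring_1 mat"
  assumes "M \<in> carrier_mat n n" "i < n" "j < n"
  shows "(M *\<^sub>v unit_vec n j) $ i = M $$ (i,j)"
  using assms by auto

lemma of_real_mat_mult_vec_index:
  assumes "M \<in> carrier_mat n n" "v \<in> carrier_vec n" "i < n"
  shows "(map_mat complex_of_real M *\<^sub>v v) $ i
    = (\<Sum>j\<in>{0..<n}. complex_of_real (M $$ (i,j)) * v $ j)"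
  using assms by (auto simp: scalar_prod_def)

lemma stable_powers_bounded:
  assumes F: "F \<in> carrier_mat n n" and st: "marginally_stable_system n F"
  obtains b where "b > 0" "\<And>x k. x \<in> carrier_vec n \<Longrightarrow> vec_norm (F ^\<^sub>m k *\<^sub>v x) \<le> b * vec_norm x"
proof -
  have Fk: "F ^\<^sub>m k \<in> carrier_mat n n" for k using F by simp
  have "\<exists>\<delta>>0. \<forall>x\<in>carrier_vec n. vec_norm x < \<delta> \<longrightarrow> (\<forall>k. vec_norm (trajectory F x k) < 1)"
    using spec[OF st[unfolded marginally_stable_system_def], of 1] by simp
  then obtain \<delta> where \<delta>: "\<delta> > 0"
    "\<And>x k. x \<in> carrier_vec n \<Longrightarrow> vec_norm x < \<delta> \<Longrightarrow> vec_norm (trajectory F x k) < 1"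
    by blast
  have "vec_norm (F ^\<^sub>m k *\<^sub>v x) \<le> 2 / \<delta> * vec_norm x" if x: "x \<in> carrier_vec n" for x k
  proof (cases "x = 0\<^sub>v n")
    case True
    have "F ^\<^sub>m k *\<^sub>v x = 0\<^sub>v n" unfolding True by (rule mult_mat_zero_vec[OF Fk])
    then have "vec_norm (F ^\<^sub>m k *\<^sub>v x) = 0" by (simp add: vec_norm_def)
    then show ?thesis using \<delta>(1) vec_norm_nonneg[of x] by simp
  next
    case False
    then have pos: "vec_norm x > 0" using vec_norm_0_iff[OF x] vec_norm_nonneg[of x] by simp
    define c where "c = \<delta> / (2 * vec_norm x)"
    have c: "c > 0" using pos \<delta>(1) by (simp add: c_def)
    have cx: "c \<cdot>\<^sub>v x \<in> carrier_vec n" using x by simp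
    have "vec_norm (c \<cdot>\<^sub>v x) < \<delta>" using pos \<delta>(1) by (simp add: vec_norm_smult c_def)
    then have "vec_norm (F ^\<^sub>m k *\<^sub>v (c \<cdot>\<^sub>v x)) < 1"
      using \<delta>(2)[OF cx, of k] by (simp only: trajectory_eq_pow[OF F cx])
    then have "c * vec_norm (F ^\<^sub>m k *\<^sub>v x) < 1"
      using c by (simp only: mult_mat_vec[OF Fk x] vec_norm_smult abs_of_pos)
    then show ?thesis using pos \<delta>(1) by (simp add: c_def field_simps)
  qed
  then show ?thesis using that[of "2 / \<delta>"] \<delta>(1) by simp
qed

text \<open>
  Otherwise \<open>F\<^sup>k x = x + k y\<close> is unbounded.
\<close>

lemma power_bounded_no_drift:
  assumes F: "F \<in> carrier_mat n n"
    and bd: "\<And>x k. x \<in> carrier_vec n \<Longrightarrow> vec_norm (F ^\<^sub>m k *\<^sub>v x) \<le> b * vec_norm x"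
    and x: "x \<in> carrier_vec n" and y: "y \<in> carrier_vec n"
    and Fx: "F *\<^sub>v x = x + y" and Fy: "F *\<^sub>v y = y"
  shows "y = 0\<^sub>v n"
proof -
  have Fk: "F ^\<^sub>m k \<in> carrier_mat n n" for k using F by simp
  have pow: "F ^\<^sub>m k *\<^sub>v x = x + real k \<cdot>\<^sub>v y" for k
  proof (induction k)
    case 0
    have "F ^\<^sub>m 0 *\<^sub>v x = x" using F x by simp
    then show ?case using x y by (intro eq_vecI) auto
  next
    case (Suc k)
    have ky: "real k \<cdot>\<^sub>v y \<in> carrier_vec n" using y by simp
    have "F ^\<^sub>m Suc k *\<^sub>v x = F *\<^sub>v (F ^\<^sub>m k *\<^sub>v x)"
      unfolding pow_mat_Suc_left[OF F] by (rule assoc_mult_mat_vec[OF F Fk x])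
    also have "\<dots> = (x + y) + real k \<cdot>\<^sub>v y"
      unfolding Suc.IH mult_add_distrib_mat_vec[OF F x ky] mult_mat_vec[OF F y] Fx Fy ..
    also have "\<dots> = x + real (Suc k) \<cdot>\<^sub>v y"
      using x y by (intro eq_vecI) (auto simp: algebra_simps)
    finally show ?case .
  qed
  have "y $ i = 0" if i: "i < n" for i
  proof (rule ccontr)
    assume "y $ i \<noteq> 0"
    then obtain k where k: "b * vec_norm x + \<bar>x $ i\<bar> < real k * \<bar>y $ i\<bar>"
      using reals_Archimedean3[of "\<bar>y $ i\<bar>"] by auto
    have "\<bar>x $ i + real k * y $ i\<bar> \<le> vec_norm (F ^\<^sub>m k *\<^sub>v x)"
      using abs_index_le_vec_norm[of i "x + real k \<cdot>\<^sub>v y"] i x y unfolding pow by simp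
    also have "\<dots> \<le> b * vec_norm x" by (rule bd[OF x])
    finally have "\<bar>real k * y $ i\<bar> \<le> b * vec_norm x + \<bar>x $ i\<bar>" by linarith
    then show False using k by (simp add: abs_mult)
  qed
  then show ?thesis using y by (intro eq_vecI) auto
qed

text \<open>
  Otherwise \<open>F\<^sup>k v = \<mu>\<^sup>k v\<close> is unbounded.
\<close>

lemma power_bounded_eigenvalue:
  assumes F: "F \<in> carrier_mat n n"
    and bd: "\<And>x k. x \<in> carrier_vec n \<Longrightarrow> vec_norm (F ^\<^sub>m k *\<^sub>v x) \<le> b * vec_norm x"
    and ev: "eigenvector (map_mat complex_of_real F) v \<mu>"
  shows "cmod \<mu> \<le> 1"
proof -
  let ?c = "map_mat complex_of_real"
  have Fk: "F ^\<^sub>m k \<in> carrier_mat n n" for k using F by simp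
  have cF: "?c F \<in> carrier_mat n n" using F by simp
  have v: "v \<in> carrier_vec n" "v \<noteq> 0\<^sub>v n" using ev cF F by (auto simp: eigenvector_def)
  have pow: "?c (F ^\<^sub>m k) *\<^sub>v v = \<mu> ^ k \<cdot>\<^sub>v v" for k
    using eigenvector_pow[OF cF ev] by (simp only: of_real_hom.mat_hom_pow[OF F])
  obtain i where i: "i < n" "v $ i \<noteq> 0"
    using v(1,2) by (metis carrier_vecD eq_vecI index_zero_vec)
  define S where "S = (\<Sum>j\<in>{0..<n}. b * cmod (v $ j))"
  have "cmod \<mu> ^ k * cmod (v $ i) \<le> S" for k
  proof -
    have ent: "\<bar>(F ^\<^sub>m k) $$ (i,j)\<bar> \<le> b" if j: "j < n" for j
    proof -
      have "\<bar>(F ^\<^sub>m k *\<^sub>v unit_vec n j) $ i\<bar> \<le> vec_norm (F ^\<^sub>m k *\<^sub>v unit_vec n j)"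
        by (rule abs_index_le_vec_norm) (simp only: dim_mult_mat_vec carrier_matD[OF Fk] i(1))
      also have "\<dots> \<le> b * vec_norm (unit_vec n j)" by (rule bd) simp
      also have "vec_norm (unit_vec n j) = 1" using j by (simp add: vec_norm_def)
      finally show ?thesis by (simp only: mult_unit_vec_index[OF Fk i(1) j] mult_1_right)
    qed
    have "cmod \<mu> ^ k * cmod (v $ i) = cmod ((?c (F ^\<^sub>m k) *\<^sub>v v) $ i)"
      unfolding pow using i v(1) by (simp add: norm_mult norm_power)
    also have "(?c (F ^\<^sub>m k) *\<^sub>v v) $ i = (\<Sum>j\<in>{0..<n}. complex_of_real ((F ^\<^sub>m k) $$ (i,j)) * v $ j)"
      by (rule of_real_mat_mult_vec_index[OF Fk v(1) i(1)])
    also have "cmod \<dots> \<le> S" unfolding S_def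
      using ent by (intro sum_norm_le) (auto simp: norm_mult intro!: mult_right_mono)
    finally show ?thesis .
  qed
  then have pb: "cmod \<mu> ^ k \<le> S / cmod (v $ i)" for k
    using i(2) by (simp add: field_simps)
  show ?thesis
  proof (rule ccontr)
    assume "\<not> cmod \<mu> \<le> 1"
    then obtain k where "S / cmod (v $ i) < cmod \<mu> ^ k" using real_arch_pow[of "cmod \<mu>"] by auto
    then show False using pb[of k] by simp
  qed
qed

text \<open>
  Strict convexity of the disk at the boundary point 1.
\<close>

lemma cmod_average_with_one_less:
  assumes \<mu>1: "cmod \<mu> \<le> 1" and \<mu>n: "\<mu> \<noteq> 1" and \<eta>: "0 < \<eta>" "\<eta> < 1"
  shows "cmod (complex_of_real \<eta> * \<mu> + complex_of_real (1 - \<eta>)) < 1"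
proof -
  let ?z = "complex_of_real \<eta> * \<mu> + complex_of_real (1 - \<eta>)"
  have "Re \<mu> < 1"
  proof (rule ccontr)
    assume r: "\<not> Re \<mu> < 1"
    have n2: "(Re \<mu>)\<^sup>2 + (Im \<mu>)\<^sup>2 \<le> 1" using \<mu>1 power_le_one[of "cmod \<mu>" 2] by (simp add: cmod_power2)
    moreover have "1 \<le> (Re \<mu>)\<^sup>2" using r by (simp add: one_le_power)
    ultimately have "(Im \<mu>)\<^sup>2 \<le> 0" by linarith
    then have "Im \<mu> = 0" by simp
    moreover have "Re \<mu> = 1" using complex_Re_le_cmod[of \<mu>] \<mu>1 r by simp
    ultimately show False using \<mu>n by (simp add: complex_eq_iff)
  qed
  have "(cmod ?z)\<^sup>2 = \<eta>\<^sup>2 * (cmod \<mu>)\<^sup>2 + 2 * \<eta> * (1 - \<eta>) * Re \<mu> + (1 - \<eta>)\<^sup>2"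
    unfolding cmod_power2 by (simp add: power2_eq_square algebra_simps)
  also have "\<dots> < \<eta>\<^sup>2 * 1 + 2 * \<eta> * (1 - \<eta>) * 1 + (1 - \<eta>)\<^sup>2"
  proof -
    have "\<eta>\<^sup>2 * (cmod \<mu>)\<^sup>2 \<le> \<eta>\<^sup>2 * 1" using \<mu>1 by (intro mult_left_mono) (auto simp: power_le_one)
    moreover have "2 * \<eta> * (1 - \<eta>) * Re \<mu> < 2 * \<eta> * (1 - \<eta>) * 1"
      using \<eta> \<open>Re \<mu> < 1\<close> by (intro mult_strict_left_mono) auto
    ultimately show ?thesis by linarith
  qed
  also have "\<dots> = 1" by (simp add: power2_eq_square algebra_simps)
  finally show ?thesis by (simp add: power_less_one_iff)
qed

text \<open>
  The eigenvectors of \<open>A\<close> and \<open>F = A / \<eta> - ((1 - \<eta>) / \<eta>) I\<close> agree, and an eigenvalue \<open>\<mu>\<close> of \<open>F\<close>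
  belongs to the eigenvalue \<open>\<eta> \<mu> + (1 - \<eta>)\<close> of \<open>A\<close>.
\<close>

lemma fixed_block_form_if_stable:
  assumes A: "A \<in> carrier_mat n n" and \<eta>: "0 < \<eta>" "\<eta> < 1"
    and st: "marginally_stable_system n (A_dt n A \<eta>)"
  shows "fixed_block_form n A"
proof -
  let ?F = "A_dt n A \<eta>"
  have F: "?F \<in> carrier_mat n n" by (rule A_dt_carrier)
  obtain b where bd: "\<And>x k. x \<in> carrier_vec n \<Longrightarrow> vec_norm (?F ^\<^sub>m k *\<^sub>v x) \<le> b * vec_norm x"
    using stable_powers_bounded[OF F st] by metis
  show ?thesis
  proof (rule fixed_block_form_if_semisimple[OF A])
    fix x :: "real vec" assume x: "x \<in> carrier_vec n" and h: "A *\<^sub>v (A *\<^sub>v x - x) = A *\<^sub>v x - x"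
    have Ax: "A *\<^sub>v x \<in> carrier_vec n" using A x by (rule mult_mat_vec_carrier)
    define y where "y = (1 / \<eta>) \<cdot>\<^sub>v (A *\<^sub>v x - x)"
    have d: "A *\<^sub>v x - x \<in> carrier_vec n" and y: "y \<in> carrier_vec n" using Ax x by (auto simp: y_def)
    have Ay: "A *\<^sub>v y = y" unfolding y_def mult_mat_vec[OF A d] h ..
    have "?F *\<^sub>v y = y" unfolding A_dt_vec[OF A y] Ay using y \<eta>
      by (intro eq_vecI) (auto simp: field_simps)
    moreover have "?F *\<^sub>v x = x + y" unfolding A_dt_vec[OF A x] y_def using x Ax A \<eta>
      by (intro eq_vecI) (auto simp: field_simps)
    ultimately have "y = 0\<^sub>v n" using power_bounded_no_drift[OF F bd x y] by blast
    moreover have "A *\<^sub>v x = x + \<eta> \<cdot>\<^sub>v y" unfolding y_def using x Ax A \<eta> by (intro eq_vecI) auto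
    ultimately show "A *\<^sub>v x = x" using x by (auto intro: eq_vecI)
  next
    fix z assume ev: "eigenvalue (map_mat complex_of_real A) z" and z1: "z \<noteq> 1"
    let ?c = "map_mat complex_of_real"
    have cA: "?c A \<in> carrier_mat n n" and cF: "?c ?F \<in> carrier_mat n n" using A F by auto
    obtain v where v: "v \<in> carrier_vec n" "v \<noteq> 0\<^sub>v n" "?c A *\<^sub>v v = z \<cdot>\<^sub>v v"
      using ev cA A by (auto simp: eigenvalue_def eigenvector_def)
    define \<mu> where "\<mu> = (z - complex_of_real (1 - \<eta>)) / complex_of_real \<eta>"
    have z\<mu>: "z = complex_of_real \<eta> * \<mu> + complex_of_real (1 - \<eta>)" using \<eta>(1) by (simp add: \<mu>_def)
    let ?a = "complex_of_real (1 / \<eta>)" and ?b = "complex_of_real ((1 - \<eta>) / \<eta>)"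
    have cs: "?a \<cdot>\<^sub>m ?c A \<in> carrier_mat n n" "?b \<cdot>\<^sub>m 1\<^sub>m n \<in> carrier_mat n n" using cA by auto
    have Fe: "?c ?F = ?a \<cdot>\<^sub>m ?c A - ?b \<cdot>\<^sub>m 1\<^sub>m n"
      unfolding A_dt_def using A by (intro eq_matI) auto
    have "?c ?F *\<^sub>v v = ?a \<cdot>\<^sub>v (z \<cdot>\<^sub>v v) - ?b \<cdot>\<^sub>v v"
      unfolding Fe minus_mult_distrib_mat_vec[OF cs v(1)] smult_mat_mult_vec[OF cA v(1)]
        smult_mat_mult_vec[OF one_carrier_mat v(1)] v(3) using v(1) by simp
    also have "\<dots> = \<mu> \<cdot>\<^sub>v v"
      using v(1) \<eta>(1) by (intro eq_vecI) (auto simp: \<mu>_def field_simps)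
    finally have "eigenvector (?c ?F) v \<mu>" using v cF F by (simp add: eigenvector_def)
    from power_bounded_eigenvalue[OF F bd this] have "cmod \<mu> \<le> 1" .
    moreover have "\<mu> \<noteq> 1" using z1 z\<mu> by auto
    ultimately show "cmod z < 1" unfolding z\<mu> using \<eta> by (intro cmod_average_with_one_less)
  qed
qed

text \<open>
  If \<open>y = A x - x\<close> is fixed by \<open>A\<close>, then \<open>A\<^sup>k y = y\<close> does not tend to 0 unless \<open>y = 0\<close>.  For an
  eigenvector \<open>v\<close> of eigenvalue \<open>z \<noteq> 1\<close> the hypothesis says that \<open>z\<^sup>k (z - 1) v\<close> tends to 0, so \<open>|z| < 1\<close>.
\<close>

lemma fixed_block_form_if_increments_vanish:
  assumes A: "A \<in> carrier_mat n n"
    and van: "\<And>x i. x \<in> carrier_vec n \<Longrightarrow> i < n \<Longrightarrow> (\<lambda>k. (A ^\<^sub>m k *\<^sub>v (A *\<^sub>v x - x)) $ i) \<longlonglongrightarrow> 0"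
  shows "fixed_block_form n A"
proof (rule fixed_block_form_if_semisimple[OF A])
  have Ak: "A ^\<^sub>m k \<in> carrier_mat n n" for k using A by simp
  {
    fix x :: "real vec" assume x: "x \<in> carrier_vec n" and h: "A *\<^sub>v (A *\<^sub>v x - x) = A *\<^sub>v x - x"
    define y where "y = A *\<^sub>v x - x"
    have Ax: "A *\<^sub>v x \<in> carrier_vec n" using A x by (rule mult_mat_vec_carrier)
    have y: "y \<in> carrier_vec n" using Ax x by (simp add: y_def)
    have "A ^\<^sub>m k *\<^sub>v y = y" for k
    proof (induction k)
      case (Suc k)
      have "A ^\<^sub>m Suc k *\<^sub>v y = A ^\<^sub>m k *\<^sub>v (A *\<^sub>v y)"
        unfolding pow_mat.simps by (rule assoc_mult_mat_vec[OF Ak A y])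
      then show ?case using Suc.IH h by (simp add: y_def)
    qed (use A y in simp)
    then have "(\<lambda>k. y $ i) \<longlonglongrightarrow> 0" if "i < n" for i
      using van[OF x that] by (simp add: y_def)
    then have "y = 0\<^sub>v n" using y by (intro eq_vecI) (auto simp: LIMSEQ_const_iff)
    moreover have "A *\<^sub>v x = x + y" unfolding y_def using x Ax A by (intro eq_vecI) auto
    ultimately show "A *\<^sub>v x = x" using x by simp
  }
  fix z assume ev: "eigenvalue (map_mat complex_of_real A) z" and z1: "z \<noteq> 1"
  let ?c = "map_mat complex_of_real"
  have cA: "?c A \<in> carrier_mat n n" using A by auto
  obtain v where v: "v \<in> carrier_vec n" "v \<noteq> 0\<^sub>v n" and evv: "eigenvector (?c A) v z"
    using ev cA by (auto simp: eigenvalue_def eigenvector_def)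
  have pow: "?c (A ^\<^sub>m k) *\<^sub>v v = z ^ k \<cdot>\<^sub>v v" for k
    using eigenvector_pow[OF cA evv] by (simp only: of_real_hom.mat_hom_pow[OF A])
  obtain i where i: "i < n" "v $ i \<noteq> 0"
    using v(1,2) by (metis carrier_vecD eq_vecI index_zero_vec)
  have ent: "(\<lambda>k. (A ^\<^sub>m Suc k) $$ (i,j) - (A ^\<^sub>m k) $$ (i,j)) \<longlonglongrightarrow> 0" if j: "j < n" for j
  proof -
    have e: "(A ^\<^sub>m k *\<^sub>v (A *\<^sub>v unit_vec n j - unit_vec n j)) $ i = (A ^\<^sub>m Suc k) $$ (i,j) - (A ^\<^sub>m k) $$ (i,j)" for k
    proof -
      have u: "unit_vec n j \<in> carrier_vec n" by simp
      have Au: "A *\<^sub>v unit_vec n j \<in> carrier_vec n" using A u by (rule mult_mat_vec_carrier)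
      have "A ^\<^sub>m k *\<^sub>v (A *\<^sub>v unit_vec n j - unit_vec n j) = A ^\<^sub>m Suc k *\<^sub>v unit_vec n j - A ^\<^sub>m k *\<^sub>v unit_vec n j"
        unfolding mult_minus_distrib_mat_vec[OF Ak Au u] pow_mat.simps assoc_mult_mat_vec[OF Ak A u] ..
      also have "\<dots> $ i = (A ^\<^sub>m Suc k) $$ (i,j) - (A ^\<^sub>m k) $$ (i,j)"
        using i(1) carrier_matD(1)[OF Ak, of k]
        by (subst index_minus_vec(1)) (simp_all only: dim_mult_mat_vec mult_unit_vec_index[OF Ak i(1) j])
      finally show ?thesis .
    qed
    show ?thesis using van[OF unit_vec_carrier[of n j] i(1)] unfolding e .
  qed
  have "(\<lambda>k. \<Sum>j\<in>{0..<n}. complex_of_real ((A ^\<^sub>m Suc k) $$ (i,j) - (A ^\<^sub>m k) $$ (i,j)) * v $ j)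
      \<longlonglongrightarrow> (\<Sum>j\<in>{0..<n}. complex_of_real 0 * v $ j)"
    using ent by (intro tendsto_sum tendsto_mult tendsto_of_real tendsto_const) auto
  moreover have "(\<Sum>j\<in>{0..<n}. complex_of_real ((A ^\<^sub>m Suc k) $$ (i,j) - (A ^\<^sub>m k) $$ (i,j)) * v $ j)
      = z ^ k * ((z - 1) * v $ i)" for k
  proof -
    have s: "(\<Sum>j\<in>{0..<n}. complex_of_real ((A ^\<^sub>m k) $$ (i,j)) * v $ j) = z ^ k * v $ i" for k
    proof -
      have "(\<Sum>j\<in>{0..<n}. complex_of_real ((A ^\<^sub>m k) $$ (i,j)) * v $ j) = (?c (A ^\<^sub>m k) *\<^sub>v v) $ i"
        by (rule of_real_mat_mult_vec_index[OF Ak v(1) i(1), symmetric])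
      then show ?thesis unfolding pow using i(1) v(1) by simp
    qed
    show ?thesis unfolding of_real_diff left_diff_distrib sum_subtractf s by (simp add: algebra_simps)
  qed
  ultimately have lim: "(\<lambda>k. z ^ k * ((z - 1) * v $ i)) \<longlonglongrightarrow> 0" by simp
  show "cmod z < 1"
  proof (rule ccontr)
    assume "\<not> cmod z < 1"
    then have "1 \<le> cmod z ^ k" for k by (intro one_le_power) simp
    then have "1 * cmod ((z - 1) * v $ i) \<le> cmod z ^ k * cmod ((z - 1) * v $ i)" for k
      by (intro mult_right_mono) auto
    then have "cmod ((z - 1) * v $ i) \<le> cmod (z ^ k * ((z - 1) * v $ i))" for k
      by (simp only: norm_mult norm_power mult_1)
    then have "cmod ((z - 1) * v $ i) \<le> 0"
      using LIMSEQ_le_const[OF tendsto_norm_zero[OF lim], of "cmod ((z - 1) * v $ i)"] by blast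
    then show False using i(2) z1 by simp
  qed
qed

lemma fixed_block_form_if_convergent:
  assumes A: "A \<in> carrier_mat n n" and conv: "convergent_system n A"
  shows "fixed_block_form n A"
proof (rule fixed_block_form_if_increments_vanish[OF A])
  fix x :: "real vec" and i assume x: "x \<in> carrier_vec n" and i: "i < n"
  have Ak: "A ^\<^sub>m k \<in> carrier_mat n n" for k using A by simp
  have Ax: "A *\<^sub>v x \<in> carrier_vec n" using A x by (rule mult_mat_vec_carrier)
  obtain y where y: "y \<in> carrier_vec n" "(\<lambda>k. vec_norm (trajectory A x k - y)) \<longlonglongrightarrow> 0"
    using conv x unfolding convergent_system_def by blast
  then have l: "(\<lambda>k. trajectory A x k $ i) \<longlonglongrightarrow> y $ i"
    using vec_norm_diff_tendsto_iff[of "trajectory A x" n y] trajectory_carrier[OF A x] i by blast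
  have "(\<lambda>k. trajectory A x (Suc k) $ i - trajectory A x k $ i) \<longlonglongrightarrow> y $ i - y $ i"
    by (intro tendsto_diff LIMSEQ_Suc l)
  moreover have "trajectory A x (Suc k) $ i - trajectory A x k $ i = (A ^\<^sub>m k *\<^sub>v (A *\<^sub>v x - x)) $ i" for k
  proof -
    have "A ^\<^sub>m k *\<^sub>v (A *\<^sub>v x - x) = trajectory A x (Suc k) - trajectory A x k"
      unfolding mult_minus_distrib_mat_vec[OF Ak Ax x] trajectory_eq_pow[OF A x] pow_mat.simps
        assoc_mult_mat_vec[OF Ak A x] ..
    then show ?thesis
      using i trajectory_carrier[OF A x, of k] by (simp del: trajectory.simps)
  qed
  ultimately show "(\<lambda>k. (A ^\<^sub>m k *\<^sub>v (A *\<^sub>v x - x)) $ i) \<longlonglongrightarrow> 0" by simp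
qed

text \<open>
  Along a trajectory, \<open>x \<bullet> P x\<close> is nonnegative and decreases in every step by at least the value of \<open>Q\<close>
  at the increment \<open>x\<^sub>k\<^sub>+\<^sub>1 - x\<^sub>k\<close>.  The decreases of a convergent sequence tend to 0, and \<open>Q\<close> controls
  the norm.
\<close>

lemma fixed_block_form_if_dissipative:
  assumes A: "A \<in> carrier_mat n n" and Q: "pos_def_mat n Q" and P: "pos_semidef_mat n P"
    and neg: "neg_semidef_mat n (A\<^sup>T * P * A - P + (A\<^sup>T - 1\<^sub>m n) * Q * (A - 1\<^sub>m n))"
  shows "fixed_block_form n A"
proof (rule fixed_block_form_if_increments_vanish[OF A])
  fix x :: "real vec" and i assume x: "x \<in> carrier_vec n" and i: "i < n"
  have Ak: "A ^\<^sub>m k \<in> carrier_mat n n" for k using A by simp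
  have Ax: "A *\<^sub>v x \<in> carrier_vec n" using A x by (rule mult_mat_vec_carrier)
  have Pc: "P \<in> carrier_mat n n" "P\<^sup>T = P" and Pn: "\<And>x. x \<in> carrier_vec n \<Longrightarrow> quad_form P x \<ge> 0"
    using P by (auto simp: pos_semidef_mat_def)
  have Qc: "Q \<in> carrier_mat n n" "Q\<^sup>T = Q" using Q by (auto simp: pos_def_mat_def)
  have dec: "quad_form Q (A *\<^sub>v w - w) \<le> quad_form P w - quad_form P (A *\<^sub>v w)"
    if w: "w \<in> carrier_vec n" for w
    using neg w neg_semidef_lyapunov_iff[OF A Pc Qc, of 1 1] unfolding one_smult_mat by force
  obtain a where a: "a > 0" "\<And>x. x \<in> carrier_vec n \<Longrightarrow> a * vec_norm x ^ 2 \<le> quad_form Q x"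
    using homogeneous_pos_def_lower_bound[OF quad_form_seq_continuous[OF Qc(1)] pos_def_mat_imp_fun[OF Q],
        of 2] quad_form_homogeneous[OF Qc(1)] by auto
  define p where "p k = quad_form P (A ^\<^sub>m k *\<^sub>v x)" for k
  define y where "y k = A ^\<^sub>m k *\<^sub>v (A *\<^sub>v x - x)" for k
  have xk: "A ^\<^sub>m k *\<^sub>v x \<in> carrier_vec n" for k using Ak x by (rule mult_mat_vec_carrier)
  have yk: "y k \<in> carrier_vec n" for k
    unfolding y_def using Ax x by (intro mult_mat_vec_carrier[OF Ak]) auto
  have step: "A *\<^sub>v (A ^\<^sub>m k *\<^sub>v x) = A ^\<^sub>m Suc k *\<^sub>v x" for k
    unfolding pow_mat_Suc_left[OF A] by (rule assoc_mult_mat_vec[OF A Ak x, symmetric])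
  have ye: "y k = A *\<^sub>v (A ^\<^sub>m k *\<^sub>v x) - A ^\<^sub>m k *\<^sub>v x" for k
    unfolding y_def step mult_minus_distrib_mat_vec[OF Ak Ax x] pow_mat.simps
      assoc_mult_mat_vec[OF Ak A x] ..
  have yp: "a * (vec_norm (y k))\<^sup>2 \<le> p k - p (Suc k)" for k
  proof -
    have "quad_form Q (y k) \<le> quad_form P (A ^\<^sub>m k *\<^sub>v x) - quad_form P (A *\<^sub>v (A ^\<^sub>m k *\<^sub>v x))"
      unfolding ye by (rule dec[OF xk])
    then show ?thesis using a(2)[OF yk[of k]] unfolding p_def step by linarith
  qed
  have "p (Suc k) \<le> p k" for k
  proof -
    have "0 \<le> a * (vec_norm (y k))\<^sup>2" using a(1) by simp
    then show ?thesis using yp[of k] by linarith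
  qed
  then have "decseq p" by (simp add: decseq_Suc_iff)
  moreover have "\<forall>k. 0 \<le> p k" using Pn[OF xk] by (simp add: p_def)
  ultimately obtain l where l: "p \<longlonglongrightarrow> l" by (rule decseq_convergent)
  have "(\<lambda>k. p k - p (Suc k)) \<longlonglongrightarrow> l - l" by (intro tendsto_diff l LIMSEQ_Suc)
  then have l0: "(\<lambda>k. (p k - p (Suc k)) / a) \<longlonglongrightarrow> 0"
    using a(1) by (auto intro: tendsto_eq_intros)
  have "(y k $ i)\<^sup>2 \<le> (p k - p (Suc k)) / a" for k
  proof -
    have "\<bar>y k $ i\<bar>\<^sup>2 \<le> (vec_norm (y k))\<^sup>2"
      using abs_index_le_vec_norm[of i "y k"] i yk[of k] by (intro power_mono) auto
    then show ?thesis using yp[of k] a(1) by (simp add: field_simps) (smt (verit) mult_left_mono)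
  qed
  then have "(\<lambda>k. (y k $ i)\<^sup>2) \<longlonglongrightarrow> 0"
    by (intro tendsto_sandwich[OF _ _ tendsto_const l0]) auto
  then show "(\<lambda>k. (A ^\<^sub>m k *\<^sub>v (A *\<^sub>v x - x)) $ i) \<longlonglongrightarrow> 0"
    unfolding y_def[symmetric] by (simp add: tendsto_null_power)
qed

section \<open>The equivalence\<close>

lemma fixed_block_form_consequences:
  assumes A: "A \<in> carrier_mat n n" and d: "fixed_block_form n A"
  shows "convergent_system n A"
    "\<exists>\<eta>. 0 < \<eta> \<and> \<eta> < 1 \<and> (\<exists>V. weak_polyhedral_lyapunov n (A_dt n A \<eta>) V)"
    "\<exists>\<eta> P. 0 < \<eta> \<and> \<eta> < 1 \<and> pos_def_mat n P \<and>
         neg_semidef_mat n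
           (\<eta> \<cdot>\<^sub>m (A\<^sup>T * P * A - P)
            + (1 - \<eta>) \<cdot>\<^sub>m ((A\<^sup>T - 1\<^sub>m n) * P * (A - 1\<^sub>m n)))"
    "\<exists>Q P. pos_def_mat n Q \<and> pos_semidef_mat n P \<and>
         vec_space.rank n P = n - kernel_dim (A - 1\<^sub>m n) \<and>
         neg_semidef_mat n
           (A\<^sup>T * P * A - P + (A\<^sup>T - 1\<^sub>m n) * Q * (A - 1\<^sub>m n))"
proof -
  obtain L \<rho>0 c where L: "L \<in> carrier_mat n n" and \<rho>0: "0 < \<rho>0" "\<rho>0 < 1" and c: "c \<ge> 0"
    and AL: "A * L = L" "L * A = L" "L * L = L" and nb: "\<And>k. norm_bound (A ^\<^sub>m k - L) (c * \<rho>0 ^ k)"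
    using fixed_block_form_pow_limit[OF A d] by metis
  obtain \<rho> N where dp: "limit_projection n A L \<rho> N"
    by (rule limit_projectionI[OF A L AL \<rho>0 c nb])
  have lim: "(\<lambda>k. (A ^\<^sub>m k) $$ (i,j)) \<longlonglongrightarrow> L $$ (i,j)" if ij: "i < n" "j < n" for i j
    by (rule geometric_bound_tendsto[OF \<rho>0])
      (use norm_bound_index[OF nb minus_carrier_mat[OF L] ij] ij L in simp)
  show "convergent_system n A" by (rule convergent_systemI[OF A L lim])
  show "\<exists>\<eta>. 0 < \<eta> \<and> \<eta> < 1 \<and> (\<exists>V. weak_polyhedral_lyapunov n (A_dt n A \<eta>) V)"
    using limit_projection.polyhedral_certificate[OF dp] by blast
  show "\<exists>\<eta> P. 0 < \<eta> \<and> \<eta> < 1 \<and> pos_def_mat n P \<and>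
         neg_semidef_mat n
           (\<eta> \<cdot>\<^sub>m (A\<^sup>T * P * A - P)
            + (1 - \<eta>) \<cdot>\<^sub>m ((A\<^sup>T - 1\<^sub>m n) * P * (A - 1\<^sub>m n)))"
    using limit_projection.quadratic_certificate[OF dp] by metis
  show "\<exists>Q P. pos_def_mat n Q \<and> pos_semidef_mat n P \<and>
         vec_space.rank n P = n - kernel_dim (A - 1\<^sub>m n) \<and>
         neg_semidef_mat n
           (A\<^sup>T * P * A - P + (A\<^sup>T - 1\<^sub>m n) * Q * (A - 1\<^sub>m n))"
    using limit_projection.quadratic_certificate[OF dp] by metis
qed

theorem proposition1:
  fixes n :: nat and A :: "real mat"
  assumes A: "A \<in> carrier_mat n n"
  shows
    "(convergent_system n A \<longleftrightarrow>
      (\<exists>\<eta>::real. 0 < \<eta> \<and> \<eta> < 1 \<and> marginally_stable_system n (A_dt n A \<eta>))) \<and>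
     (convergent_system n A \<longleftrightarrow>
      (\<exists>\<eta>::real. 0 < \<eta> \<and> \<eta> < 1 \<and> (\<exists>V. weak_polyhedral_lyapunov n (A_dt n A \<eta>) V))) \<and>
     (convergent_system n A \<longleftrightarrow>
      (\<exists>(m::nat) (r::nat) (T::real mat) (T_inv::real mat) (A_as::real mat) (A_r::real mat).
         m + r = n \<and> T \<in> carrier_mat n n \<and> T_inv \<in> carrier_mat n n \<and>
         inverts_mat T T_inv \<and> inverts_mat T_inv T \<and>
         A_as \<in> carrier_mat m m \<and> schur_mat A_as \<and> A_r \<in> carrier_mat r m \<and>
         T_inv * A * T = four_block_mat A_as (0\<^sub>m m r) A_r (1\<^sub>m r))) \<and>
     (convergent_system n A \<longleftrightarrow>
      (\<exists>(\<eta>::real) (P::real mat). 0 < \<eta> \<and> \<eta> < 1 \<and> pos_def_mat n P \<and>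
         neg_semidef_mat n
           (\<eta> \<cdot>\<^sub>m (A\<^sup>T * P * A - P)
            + (1 - \<eta>) \<cdot>\<^sub>m ((A\<^sup>T - 1\<^sub>m n) * P * (A - 1\<^sub>m n))))) \<and>
     (convergent_system n A \<longleftrightarrow>
      (\<exists>(Q::real mat) (P::real mat). pos_def_mat n Q \<and> pos_semidef_mat n P \<and>
         vec_space.rank n P = n - kernel_dim (A - 1\<^sub>m n) \<and>
         neg_semidef_mat n
           (A\<^sup>T * P * A - P + (A\<^sup>T - 1\<^sub>m n) * Q * (A - 1\<^sub>m n))))"
  unfolding fixed_block_form_def[symmetric]
proof (intro conjI)
  have ad: "fixed_block_form n A" if "convergent_system n A"
    by (rule fixed_block_form_if_convergent[OF A that])
  note d = fixed_block_form_consequences[OF A]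
  have bd: "fixed_block_form n A"
    if "\<exists>\<eta>. 0 < \<eta> \<and> \<eta> < 1 \<and> marginally_stable_system n (A_dt n A \<eta>)"
    using that fixed_block_form_if_stable[OF A] by blast
  have cb: "\<exists>\<eta>. 0 < \<eta> \<and> \<eta> < 1 \<and> marginally_stable_system n (A_dt n A \<eta>)"
    if "\<exists>\<eta>. 0 < \<eta> \<and> \<eta> < 1 \<and> (\<exists>V. weak_polyhedral_lyapunov n (A_dt n A \<eta>) V)"
    using that polyhedral_imp_stable[OF A_dt_carrier] by blast
  show "convergent_system n A \<longleftrightarrow>
      (\<exists>\<eta>::real. 0 < \<eta> \<and> \<eta> < 1 \<and> marginally_stable_system n (A_dt n A \<eta>))"
    using ad d(1,2) cb bd by metis
  show "convergent_system n A \<longleftrightarrow>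
      (\<exists>\<eta>::real. 0 < \<eta> \<and> \<eta> < 1 \<and> (\<exists>V. weak_polyhedral_lyapunov n (A_dt n A \<eta>) V))"
    using ad d(1,2) cb bd by metis
  show "convergent_system n A \<longleftrightarrow> fixed_block_form n A"
    using ad d(1) by blast
  show "convergent_system n A \<longleftrightarrow>
      (\<exists>(\<eta>::real) (P::real mat). 0 < \<eta> \<and> \<eta> < 1 \<and> pos_def_mat n P \<and>
         neg_semidef_mat n
           (\<eta> \<cdot>\<^sub>m (A\<^sup>T * P * A - P)
            + (1 - \<eta>) \<cdot>\<^sub>m ((A\<^sup>T - 1\<^sub>m n) * P * (A - 1\<^sub>m n))))"
    using ad d(1,3) quadratic_imp_stable[OF A] bd by metis
  show "convergent_system n A \<longleftrightarrow>
      (\<exists>(Q::real mat) (P::real mat). pos_def_mat n Q \<and> pos_semidef_mat n P \<and>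
         vec_space.rank n P = n - kernel_dim (A - 1\<^sub>m n) \<and>
         neg_semidef_mat n
           (A\<^sup>T * P * A - P + (A\<^sup>T - 1\<^sub>m n) * Q * (A - 1\<^sub>m n)))"
    using ad d(1,4) fixed_block_form_if_dissipative[OF A] by metis
qed

end
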